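(* Let $E$ be a Hausdorff locally convex space, $U\subseteq\mathbb R^n$ and $V\subseteq\mathbb R^m$ be open subsets, and $k,l\in\mathbb N_0\cup\{\infty\}$. Let $\mathcal W_1\subseteq C^k(U,[0,\infty))$ be a set of weights on $U$ such that (i) $\mathcal W_1$ satisfies the $o$-condition, (ii) for each $f\in\mathcal W_1$ and $\alpha\in\mathbb N_0^n$ with $|\alpha|\le k$ there exists $g\in\mathcal W_1$ such that $\left|\frac{\partial^\alpha}{\partial x^\alpha}f(x)\right|\le g(x)$ for all $x\in U$. Likewise, let $\mathcal W_2\subseteq C^l(V,[0,\infty))$ be a set of weights on $V$ which satisfies the $o$-condition and such that for each $f\in\mathcal W_2$ and $\beta\in\mathbb N_0^m$ with $|\beta|\le l$ there exists $g\in\mathcal W_2$ with $\left|\frac{\partial^\beta}{\partial y^\beta}f(y)\right|\le g(y)$ for all $y\in V$. Then the linear map $$\Psi:C^k_{\mathcal W_1}(U,C^l_{\mathcal W_2}(V,E))\to C^l_{\mathcal W_2}(V,C^k_{\mathcal W_1}(U,E)),\quad \Psi(\gamma):=\big(y\mapsto(x\mapsto\gamma(x)(y))\big)$$ is a homeomorphism.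
   Context: Topological vector spaces are over $\mathbb K\in\{\mathbb R,\mathbb C\}$; $\mathcal P_E$ is the set of all continuous seminorms on a locally convex space $E$; $\mathbb N_0=\{0,1,2,\dots\}$. For $U\subseteq\mathbb R^n$ open and $E$ Hausdorff locally convex, $C^k(U,E)$ is the space of continuous maps $\gamma:U\to E$ all of whose iterated partial derivatives $\frac{\partial^\alpha}{\partial x^\alpha}\gamma:U\to E$ with $|\alpha|\le k$ exist and are continuous. $C^k(U,[0,\infty))$ denotes the real-valued $C^k$-functions with values in $[0,\infty)$. A set of weights on a Hausdorff space $X$ is a nonempty set $\mathcal W$ of functions $f:X\to[0,\infty)$ such that for each $x\in X$ there is $f_x\in\mathcal W$ with $f_x(x)>0$. For $f,g:X\to[0,\infty)$, $f=o(g)$ means: for each $\varepsilon>0$ there is a compact $K_\varepsilon\subseteq X$ with $f\le\varepsilon g$ on $X\setminus K_\varepsilon$. $\mathcal W$ satisfies the $o$-condition if for each $f\in\mathcal W$ there is $g\in\mathcal W$ with $f=o(g)$. $C^k_{\mathcal W}(U,E)$ is the space of all $\gamma\in C^k(U,E)$ with $\|\gamma\|_{f,\alpha,q}:=\sup_{x\in U}f(x)q(\frac{\partial^\alpha}{\partial x^\alpha}\gamma(x))<\infty$ for all $f\in\mathcal W$, $q\in\mathcal P_E$, $|\alpha|\le k$, with the (Hausdorff) locally convex topology defined by these seminorms. *)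

theory Defs
  imports "HOL-Analysis.Analysis" "HOL-Library.Function_Algebras"
begin

section \<open>Locally convex spaces\<close>

text \<open>
  A topological vector space is given by a scalar multiplication \<open>sc\<close> on an ambient
  additive group and a topology \<open>T\<close> whose underlying set \<open>topspace T\<close> is a linear subspace;
  this way function spaces over arbitrary open sets are again of the same kind.
  The scalars range over the class \<open>real_normed_field\<close>. As the norm is multiplicative there, the
  only instances are the real and the complex numbers, up to isometric isomorphism
  (Gelfand-Mazur).
\<close>

locale locally_convex_space = vector_space sc
  for sc :: "'k::real_normed_field \<Rightarrow> 'e::ab_group_add \<Rightarrow> 'e" +
  fixes T :: "'e topology"
  assumes subspace_topspace: "subspace (topspace T)"
    and continuous_add: "continuous_map (prod_topology T T) T (\<lambda>(u, v). u + v)"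
    and continuous_scale: "continuous_map (prod_topology euclidean T) T (\<lambda>(c, u). sc c u)"
    and locally_convex:
      "\<And>N. openin T N \<Longrightarrow> 0 \<in> N \<Longrightarrow>
         \<exists>M C. openin T M \<and> 0 \<in> M \<and> M \<subseteq> C \<and> C \<subseteq> N \<and>
           (\<forall>u\<in>C. \<forall>v\<in>C. \<forall>t\<in>{0..1::real}.
              sc (of_real (1 - t)) u + sc (of_real t) v \<in> C)"

definition continuous_seminorms ::
    "('k::real_normed_field \<Rightarrow> 'e::ab_group_add \<Rightarrow> 'e) \<Rightarrow> 'e topology \<Rightarrow> ('e \<Rightarrow> real) set" where
  "continuous_seminorms sc T = {q.
     continuous_map T euclideanreal q \<and>
     (\<forall>u\<in>topspace T. 0 \<le> q u) \<and>
     (\<forall>u\<in>topspace T. \<forall>v\<in>topspace T. q (u + v) \<le> q u + q v) \<and>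
     (\<forall>c. \<forall>u\<in>topspace T. q (sc c u) = norm c * q u)}"

text \<open>Pointwise scalar multiplication; the pointwise additive structure on functions
  comes from \<open>HOL-Library.Function_Algebras\<close>.\<close>

definition fun_scale :: "('k \<Rightarrow> 'e \<Rightarrow> 'e) \<Rightarrow> 'k \<Rightarrow> ('x \<Rightarrow> 'e) \<Rightarrow> 'x \<Rightarrow> 'e" where
  "fun_scale sc c \<gamma> = (\<lambda>x. sc c (\<gamma> x))"

section \<open>Partial derivatives and $C^k$-maps\<close>

definition has_partial_derivative ::
    "('k::real_normed_field \<Rightarrow> 'e::ab_group_add \<Rightarrow> 'e) \<Rightarrow> 'e topology \<Rightarrow>
     'n \<Rightarrow> (real^'n \<Rightarrow> 'e) \<Rightarrow> real^'n \<Rightarrow> 'e \<Rightarrow> bool" where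
  "has_partial_derivative sc T i \<gamma> x d \<longleftrightarrow>
     limitin T (\<lambda>t. sc (of_real (1 / t)) (\<gamma> (x + t *\<^sub>R axis i 1) - \<gamma> x)) d (at (0::real))"

text \<open>A map defined on \<open>U\<close> is represented by its extension by \<open>0\<close> to the whole type.
  The limit below is unique whenever \<open>T\<close> is Hausdorff.\<close>

definition partial_derivative ::
    "('k::real_normed_field \<Rightarrow> 'e::ab_group_add \<Rightarrow> 'e) \<Rightarrow> 'e topology \<Rightarrow> (real^'n) set \<Rightarrow>
     'n \<Rightarrow> (real^'n \<Rightarrow> 'e) \<Rightarrow> real^'n \<Rightarrow> 'e" where
  "partial_derivative sc T U i \<gamma> =
     (\<lambda>x. if x \<in> U then THE d. has_partial_derivative sc T i \<gamma> x d else 0)"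

primrec iterated_partial ::
    "('k::real_normed_field \<Rightarrow> 'e::ab_group_add \<Rightarrow> 'e) \<Rightarrow> 'e topology \<Rightarrow> (real^'n) set \<Rightarrow>
     'n list \<Rightarrow> (real^'n \<Rightarrow> 'e) \<Rightarrow> real^'n \<Rightarrow> 'e" where
  "iterated_partial sc T U [] \<gamma> = \<gamma>"
| "iterated_partial sc T U (i # w) \<gamma> =
     partial_derivative sc T U i (iterated_partial sc T U w \<gamma>)"

primrec iterated_partial_exists ::
    "('k::real_normed_field \<Rightarrow> 'e::ab_group_add \<Rightarrow> 'e) \<Rightarrow> 'e topology \<Rightarrow> (real^'n) set \<Rightarrow>
     'n list \<Rightarrow> (real^'n \<Rightarrow> 'e) \<Rightarrow> bool" where
  "iterated_partial_exists sc T U [] \<gamma> \<longleftrightarrow> True"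
| "iterated_partial_exists sc T U (i # w) \<gamma> \<longleftrightarrow>
     iterated_partial_exists sc T U w \<gamma> \<and>
     (\<forall>x\<in>U. \<exists>d. has_partial_derivative sc T i (iterated_partial sc T U w \<gamma>) x d)"

text \<open>For a multi-index \<open>\<alpha>\<close>, the operator $\partial^\alpha/\partial x^\alpha$ is
  $(\partial/\partial x_1)^{\alpha_1}\cdots(\partial/\partial x_n)^{\alpha_n}$, where the
  coordinates are enumerated along the linear order of the index type. By Schwarz's theorem this
  choice of order is immaterial for $C^k$-maps.\<close>

definition multi_index_word :: "('n::{finite,linorder} \<Rightarrow> nat) \<Rightarrow> 'n list" where
  "multi_index_word \<alpha> = concat (map (\<lambda>i. replicate (\<alpha> i) i) (sorted_list_of_set UNIV))"

definition multi_partial_exists ::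
    "('k::real_normed_field \<Rightarrow> 'e::ab_group_add \<Rightarrow> 'e) \<Rightarrow> 'e topology \<Rightarrow>
     (real^'n::{finite,linorder}) set \<Rightarrow> ('n \<Rightarrow> nat) \<Rightarrow> (real^'n::{finite,linorder} \<Rightarrow> 'e) \<Rightarrow>
     bool" where
  "multi_partial_exists sc T U \<alpha> \<gamma> = iterated_partial_exists sc T U (multi_index_word \<alpha>) \<gamma>"

definition multi_partial ::
    "('k::real_normed_field \<Rightarrow> 'e::ab_group_add \<Rightarrow> 'e) \<Rightarrow> 'e topology \<Rightarrow>
     (real^'n::{finite,linorder}) set \<Rightarrow> ('n \<Rightarrow> nat) \<Rightarrow> (real^'n::{finite,linorder} \<Rightarrow> 'e) \<Rightarrow>
     real^'n::{finite,linorder} \<Rightarrow> 'e" where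
  "multi_partial sc T U \<alpha> \<gamma> = iterated_partial sc T U (multi_index_word \<alpha>) \<gamma>"

definition abs_index :: "('n::finite \<Rightarrow> nat) \<Rightarrow> nat" where
  "abs_index \<alpha> = (\<Sum>i\<in>UNIV. \<alpha> i)"

text \<open>Continuity of the map itself is the case \<open>\<alpha> = 0\<close>.\<close>

definition Ck ::
    "('k::real_normed_field \<Rightarrow> 'e::ab_group_add \<Rightarrow> 'e) \<Rightarrow> 'e topology \<Rightarrow> enat \<Rightarrow>
     (real^'n::{finite,linorder}) set \<Rightarrow> (real^'n::{finite,linorder} \<Rightarrow> 'e) set" where
  "Ck sc T k U = {\<gamma>.
     (\<forall>x. x \<notin> U \<longrightarrow> \<gamma> x = 0) \<and>
     (\<forall>\<alpha>. enat (abs_index \<alpha>) \<le> k \<longrightarrow>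
        multi_partial_exists sc T U \<alpha> \<gamma> \<and>
        continuous_map (top_of_set U) T (multi_partial sc T U \<alpha> \<gamma>))}"

abbreviation real_partial ::
    "(real^'n::{finite,linorder}) set \<Rightarrow> ('n \<Rightarrow> nat) \<Rightarrow> (real^'n::{finite,linorder} \<Rightarrow> real) \<Rightarrow>
     real^'n::{finite,linorder} \<Rightarrow> real" where
  "real_partial \<equiv> multi_partial (*) euclideanreal"

definition Ck_nonneg ::
    "enat \<Rightarrow> (real^'n::{finite,linorder}) set \<Rightarrow> (real^'n::{finite,linorder} \<Rightarrow> real) set" where
  "Ck_nonneg k U = {f \<in> Ck (*) euclideanreal k U. \<forall>x\<in>U. 0 \<le> f x}"

section \<open>Weights\<close>

definition set_of_weights :: "'x set \<Rightarrow> ('x \<Rightarrow> real) set \<Rightarrow> bool" where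
  "set_of_weights X W \<longleftrightarrow>
     W \<noteq> {} \<and> (\<forall>f\<in>W. \<forall>x\<in>X. 0 \<le> f x) \<and> (\<forall>x\<in>X. \<exists>f\<in>W. 0 < f x)"

definition little_o_on :: "'x::topological_space set \<Rightarrow> ('x \<Rightarrow> real) \<Rightarrow> ('x \<Rightarrow> real) \<Rightarrow> bool" where
  "little_o_on X f g \<longleftrightarrow>
     (\<forall>\<epsilon>>0. \<exists>K. compact K \<and> K \<subseteq> X \<and> (\<forall>x\<in>X - K. f x \<le> \<epsilon> * g x))"

definition o_condition :: "'x::topological_space set \<Rightarrow> ('x \<Rightarrow> real) set \<Rightarrow> bool" where
  "o_condition X W \<longleftrightarrow> (\<forall>f\<in>W. \<exists>g\<in>W. little_o_on X f g)"

section \<open>Weighted function spaces\<close>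

text \<open>The supremum is taken in $[0,\infty]$.\<close>

definition weighted_seminorm ::
    "('k::real_normed_field \<Rightarrow> 'e::ab_group_add \<Rightarrow> 'e) \<Rightarrow> 'e topology \<Rightarrow>
     (real^'n::{finite,linorder}) set \<Rightarrow> (real^'n::{finite,linorder} \<Rightarrow> real) \<Rightarrow> ('n \<Rightarrow> nat) \<Rightarrow>
     ('e \<Rightarrow> real) \<Rightarrow>
     (real^'n::{finite,linorder} \<Rightarrow> 'e) \<Rightarrow> ennreal" where
  "weighted_seminorm sc T U f \<alpha> q \<gamma> =
     (SUP x\<in>U. ennreal (f x * q (multi_partial sc T U \<alpha> \<gamma> x)))"

definition weighted_Ck ::
    "('k::real_normed_field \<Rightarrow> 'e::ab_group_add \<Rightarrow> 'e) \<Rightarrow> 'e topology \<Rightarrow> enat \<Rightarrow>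
     (real^'n::{finite,linorder} \<Rightarrow> real) set \<Rightarrow> (real^'n::{finite,linorder}) set \<Rightarrow>
     (real^'n::{finite,linorder} \<Rightarrow> 'e) set" where
  "weighted_Ck sc T k W U = {\<gamma> \<in> Ck sc T k U.
     \<forall>f\<in>W. \<forall>q\<in>continuous_seminorms sc T. \<forall>\<alpha>. enat (abs_index \<alpha>) \<le> k \<longrightarrow>
       weighted_seminorm sc T U f \<alpha> q \<gamma> < \<infinity>}"

text \<open>The topology defined by a family of seminorms has the open balls of the seminorms
  (around all points) as a subbase; the whole space is included for the case of an empty family.\<close>

definition weighted_Ck_topology ::
    "('k::real_normed_field \<Rightarrow> 'e::ab_group_add \<Rightarrow> 'e) \<Rightarrow> 'e topology \<Rightarrow> enat \<Rightarrow>
     (real^'n::{finite,linorder} \<Rightarrow> real) set \<Rightarrow> (real^'n::{finite,linorder}) set \<Rightarrow>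
     (real^'n::{finite,linorder} \<Rightarrow> 'e) topology" where
  "weighted_Ck_topology sc T k W U = topology_generated_by
     (insert (weighted_Ck sc T k W U)
       {{\<eta> \<in> weighted_Ck sc T k W U. weighted_seminorm sc T U f \<alpha> q (\<eta> - \<gamma>) < ennreal r}
         | \<gamma> f \<alpha> q r. \<gamma> \<in> weighted_Ck sc T k W U \<and> f \<in> W \<and> enat (abs_index \<alpha>) \<le> k \<and>
             q \<in> continuous_seminorms sc T \<and> 0 < r})"

lemma topspace_weighted_Ck_topology [simp]:
  "topspace (weighted_Ck_topology sc T k W U) = weighted_Ck sc T k W U"
  unfolding weighted_Ck_topology_def topology_generated_by_topspace by auto

end

theory Submission
  imports Defs "HOL-Library.Multiset"
begin

text \<open>
  An element \<open>\<gamma>\<close> of the nested space on the left is a function of two variables whose mixed partial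
  derivatives \<open>A u w x y\<close>, along \<open>u\<close> in \<open>x\<close> and along \<open>w\<close> in \<open>y\<close>, have five properties that treat
  \<open>x\<close> and \<open>y\<close> alike: they vanish outside \<open>U \<times> V\<close>, take values in \<open>E\<close>, are the partial derivatives
  of each other in both variables, are jointly continuous, and satisfy
  \<open>sup f x * g y * q (A u w x y) < \<infinity>\<close> for all weights \<open>f\<close>, \<open>g\<close> and continuous seminorms \<open>q\<close>
  (\<open>mixed_family_nested\<close>).  The only limit argument here is that evaluation of a derivative at a
  point is a continuous linear map on a weighted space (\<open>limitin_evaluation\<close>), because some weight
  is positive there.  Evaluating a derivative in \<open>y\<close> therefore commutes with differentiating in \<open>x\<close>.

  Conversely, such a family is an element of the nested space on the right (\<open>slices_space\<close>).  What has
  to be shown is convergence in the topology of the inner weighted space, that is, uniformly in \<open>x\<close> after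
  multiplication by a weight \<open>f\<close>.  The o-condition provides it: off a compact set \<open>f\<close> is a small
  multiple of a weight \<open>g\<close> for which the derivatives are bounded, locally uniformly in \<open>y\<close>, and on
  the compact set joint continuity is uniform (\<open>slice_uniformly_continuous\<close>).  Difference quotients
  in \<open>y\<close> reduce to this by a mean value estimate for seminorms (\<open>difference_quotient_bound\<close>).

  Since the properties of the family are symmetric, the exchange of variables is a bijection whose
  inverse is of the same form.  It is continuous because a continuous seminorm on a weighted
  space is bounded by a finite sum of weighted norms, and for weighted norms the exchange only swaps
  two iterated suprema (\<open>exchange_norm_le\<close>, \<open>exchange_seminorm_dominated\<close>).

  All spaces are handled as subspaces topologized by their continuous seminorms.  For \<open>E\<close> these
  are supplied by Minkowski functionals; weighted spaces inherit the property, so a statement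
  about weighted spaces over \<open>E\<close> also covers weighted spaces over weighted spaces.
\<close>

section \<open>Topologies defined by seminorms\<close>

definition seminorm_on ::
    "('k::real_normed_field \<Rightarrow> 'e::ab_group_add \<Rightarrow> 'e) \<Rightarrow> 'e set \<Rightarrow> ('e \<Rightarrow> real) \<Rightarrow> bool" where
  "seminorm_on sc S q \<longleftrightarrow> (\<forall>u\<in>S. 0 \<le> q u) \<and> (\<forall>u\<in>S. \<forall>v\<in>S. q (u + v) \<le> q u + q v) \<and>
     (\<forall>c. \<forall>u\<in>S. q (sc c u) = norm c * q u)"

lemma continuous_seminorms_iff:
  "q \<in> continuous_seminorms sc T \<longleftrightarrow>
     continuous_map T euclideanreal q \<and> seminorm_on sc (topspace T) q"
  unfolding continuous_seminorms_def seminorm_on_def by blast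

lemma seminorm_on_nonneg: "seminorm_on sc S q \<Longrightarrow> u \<in> S \<Longrightarrow> 0 \<le> q u"
  and seminorm_on_triangle: "seminorm_on sc S q \<Longrightarrow> u \<in> S \<Longrightarrow> v \<in> S \<Longrightarrow> q (u + v) \<le> q u + q v"
  and seminorm_on_scale: "seminorm_on sc S q \<Longrightarrow> u \<in> S \<Longrightarrow> q (sc c u) = norm c * q u"
  unfolding seminorm_on_def by blast+

locale seminormed_subspace = vector_space sc
  for sc :: "'k::real_normed_field \<Rightarrow> 'e::ab_group_add \<Rightarrow> 'e" +
  fixes S :: "'e set"
  assumes subspace_S: "subspace S"
begin

lemma seminorm_0: "seminorm_on sc S q \<Longrightarrow> q 0 = 0"
  using seminorm_on_scale[of sc S q 0 0] subspace_0[OF subspace_S] by simp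

lemma seminorm_minus: "seminorm_on sc S q \<Longrightarrow> u \<in> S \<Longrightarrow> q (- u) = q u"
  using seminorm_on_scale[of sc S q u "-1"] by simp

lemma seminorm_diff_commute:
  "seminorm_on sc S q \<Longrightarrow> u \<in> S \<Longrightarrow> v \<in> S \<Longrightarrow> q (u - v) = q (v - u)"
  using seminorm_minus[of q "u - v"] subspace_diff[OF subspace_S, of u v] by simp

lemma seminorm_diff_triangle:
  assumes "seminorm_on sc S q" "u \<in> S" "v \<in> S" "w \<in> S"
  shows "q (u - w) \<le> q (u - v) + q (v - w)"
  using seminorm_on_triangle[OF assms(1), of "u - v" "v - w"] subspace_diff[OF subspace_S] assms
  by simp

lemma seminorm_triangle_diff:
  assumes "seminorm_on sc S q" "u \<in> S" "v \<in> S"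
  shows "\<bar>q u - q v\<bar> \<le> q (u - v)"
  using seminorm_on_triangle[OF assms(1), of "u - v" v] seminorm_on_triangle[OF assms(1), of "v - u" u]
    subspace_diff[OF subspace_S] assms seminorm_diff_commute[OF assms]
  by (simp add: abs_le_iff)

lemma seminorm_on_mult_sum:
  assumes "0 \<le> C" "\<And>i. i \<in> I \<Longrightarrow> seminorm_on sc S (p i)"
  shows "seminorm_on sc S (\<lambda>u. C * (\<Sum>i\<in>I. p i u))"
  unfolding seminorm_on_def
proof (intro conjI ballI allI)
  fix u assume "u \<in> S"
  then show "0 \<le> C * (\<Sum>i\<in>I. p i u)"
    using assms by (intro mult_nonneg_nonneg sum_nonneg) (auto intro: seminorm_on_nonneg)
next
  fix u v assume "u \<in> S" "v \<in> S"
  then have "(\<Sum>i\<in>I. p i (u + v)) \<le> (\<Sum>i\<in>I. p i u + p i v)"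
    using assms(2) by (intro sum_mono) (auto intro: seminorm_on_triangle)
  then show "C * (\<Sum>i\<in>I. p i (u + v)) \<le> C * (\<Sum>i\<in>I. p i u) + C * (\<Sum>i\<in>I. p i v)"
    using assms(1) by (simp add: sum.distrib distrib_left[symmetric] mult_left_mono)
next
  fix c u assume "u \<in> S"
  then have "(\<Sum>i\<in>I. p i (sc c u)) = (\<Sum>i\<in>I. norm c * p i u)"
    using assms(2) by (intro sum.cong) (auto intro: seminorm_on_scale)
  then show "C * (\<Sum>i\<in>I. p i (sc c u)) = norm c * (C * (\<Sum>i\<in>I. p i u))"
    by (simp add: sum_distrib_left algebra_simps)
qed

end

text \<open>
  The working notion: a subspace whose topology is given by its continuous seminorms, which
  separate points.  Hausdorff locally convex spaces are of this kind, and weighted function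
  spaces with values in such a space are again, so nested function spaces are covered as well.
\<close>

locale seminorm_space = seminormed_subspace sc "topspace T"
  for sc :: "'k::real_normed_field \<Rightarrow> 'e::ab_group_add \<Rightarrow> 'e" and T :: "'e topology" +
  assumes openin_contains_ball: "openin T N \<Longrightarrow> u \<in> N \<Longrightarrow>
      \<exists>q\<in>continuous_seminorms sc T. {v \<in> topspace T. q (v - u) < 1} \<subseteq> N"
    and openin_ball: "q \<in> continuous_seminorms sc T \<Longrightarrow> u \<in> topspace T \<Longrightarrow>
      openin T {v \<in> topspace T. q (v - u) < r}"
    and separating: "u \<in> topspace T \<Longrightarrow> (\<And>q. q \<in> continuous_seminorms sc T \<Longrightarrow> q u = 0) \<Longrightarrow> u = 0"
begin

abbreviation "CS \<equiv> continuous_seminorms sc T"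

lemma CS_seminorm: "q \<in> CS \<Longrightarrow> seminorm_on sc (topspace T) q"
  by (simp add: continuous_seminorms_iff)

lemmas CS_nonneg = seminorm_on_nonneg[OF CS_seminorm]
  and CS_triangle = seminorm_on_triangle[OF CS_seminorm]
  and CS_scale = seminorm_on_scale[OF CS_seminorm]
  and CS_0 = seminorm_0[OF CS_seminorm]
  and CS_diff_commute = seminorm_diff_commute[OF CS_seminorm]
  and CS_diff_triangle = seminorm_diff_triangle[OF CS_seminorm]

lemma CS_mult_sum:
  assumes "0 \<le> C" "finite I" "\<And>i. i \<in> I \<Longrightarrow> p i \<in> CS"
  shows "(\<lambda>u. C * (\<Sum>i\<in>I. p i u)) \<in> CS"
proof -
  have "continuous_map T euclideanreal (\<lambda>u. C * (\<Sum>i\<in>I. p i u))"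
    using assms by (intro continuous_intros) (auto simp: continuous_seminorms_iff)
  moreover have "seminorm_on sc (topspace T) (\<lambda>u. C * (\<Sum>i\<in>I. p i u))"
    using assms by (intro seminorm_on_mult_sum) (auto simp: continuous_seminorms_iff)
  ultimately show ?thesis by (simp add: continuous_seminorms_iff)
qed

lemma CS_mult: "0 \<le> C \<Longrightarrow> q \<in> CS \<Longrightarrow> (\<lambda>u. C * q u) \<in> CS"
  using CS_mult_sum[of C "{()}" "\<lambda>_. q"] by simp

lemma limitin_seminorm_iff:
  "limitin T h l F \<longleftrightarrow> l \<in> topspace T \<and>
     (\<forall>q\<in>CS. \<forall>e>0. \<forall>\<^sub>F x in F. h x \<in> topspace T \<and> q (h x - l) < e)"
proof
  assume L: "limitin T h l F"
  then have l: "l \<in> topspace T" by (simp add: limitin_def)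
  moreover have "\<forall>\<^sub>F x in F. h x \<in> topspace T \<and> q (h x - l) < e" if "q \<in> CS" "e > 0" for q e
  proof -
    have "l \<in> {v \<in> topspace T. q (v - l) < e}" using that l CS_0[OF that(1)] by simp
    then show ?thesis using L openin_ball[OF that(1) l, of e] unfolding limitin_def by fastforce
  qed
  ultimately show "l \<in> topspace T \<and>
     (\<forall>q\<in>CS. \<forall>e>0. \<forall>\<^sub>F x in F. h x \<in> topspace T \<and> q (h x - l) < e)" by blast
next
  assume R: "l \<in> topspace T \<and>
     (\<forall>q\<in>CS. \<forall>e>0. \<forall>\<^sub>F x in F. h x \<in> topspace T \<and> q (h x - l) < e)"
  show "limitin T h l F"
    unfolding limitin_def
  proof (intro conjI allI impI)
    show "l \<in> topspace T" using R by blast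
    fix N assume "openin T N \<and> l \<in> N"
    then obtain q where q: "q \<in> CS" "{v \<in> topspace T. q (v - l) < 1} \<subseteq> N"
      using openin_contains_ball by blast
    then have "\<forall>\<^sub>F x in F. h x \<in> topspace T \<and> q (h x - l) < 1" using R by simp
    then show "\<forall>\<^sub>F x in F. h x \<in> N" by (rule eventually_mono) (use q in auto)
  qed
qed

lemma limitin_seminormD:
  "limitin T h l F \<Longrightarrow> q \<in> CS \<Longrightarrow> 0 < e \<Longrightarrow> \<forall>\<^sub>F x in F. h x \<in> topspace T \<and> q (h x - l) < e"
  unfolding limitin_seminorm_iff by blast

lemma limitin_unique:
  assumes "limitin T h l F" "limitin T h l' F" "F \<noteq> bot"
  shows "l = l'"
proof -
  have l: "l \<in> topspace T" "l' \<in> topspace T" using assms by (auto simp: limitin_def)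
  have "q (l - l') = 0" if q: "q \<in> CS" for q
  proof (rule antisym)
    show "0 \<le> q (l - l')" using q l CS_nonneg subspace_diff[OF subspace_S] by blast
    show "q (l - l') \<le> 0"
    proof (rule field_le_epsilon)
      fix e :: real assume e: "e > 0"
      have "\<forall>\<^sub>F x in F. (h x \<in> topspace T \<and> q (h x - l) < e/2) \<and> (h x \<in> topspace T \<and> q (h x - l') < e/2)"
        using half_gt_zero[OF e]
        by (intro eventually_conj[OF limitin_seminormD[OF assms(1) q] limitin_seminormD[OF assms(2) q]])
      then obtain x where x: "h x \<in> topspace T" "q (h x - l) < e/2" "q (h x - l') < e/2"
        using eventually_happens'[OF assms(3)] by blast
      then show "q (l - l') \<le> 0 + e"
        using CS_diff_triangle[OF q l(1) x(1) l(2)] CS_diff_commute[OF q l(1) x(1)] by linarith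
    qed
  qed
  then have "l - l' = 0" using separating l subspace_diff[OF subspace_S] by blast
  then show ?thesis by simp
qed

end

lemma continuous_map_open_iff_limitin:
  assumes "open U"
  shows "continuous_map (top_of_set U) T g \<longleftrightarrow> (\<forall>x\<in>U. limitin T g (g x) (at x))"
proof -
  have "atin (top_of_set U) x = at x" if x: "x \<in> U" for x
  proof (rule filter_eqI)
    fix P
    show "eventually P (atin (top_of_set U) x) \<longleftrightarrow> eventually P (at x)"
      unfolding eventually_atin eventually_at_topological openin_open_eq[OF assms]
    proof
      assume "x \<notin> topspace (top_of_set U) \<or>
        (\<exists>N. (open N \<and> N \<subseteq> U) \<and> x \<in> N \<and> (\<forall>y\<in>N - {x}. P y))"
      then show "\<exists>S. open S \<and> x \<in> S \<and> (\<forall>y\<in>S. y \<noteq> x \<longrightarrow> y \<in> UNIV \<longrightarrow> P y)" using x by auto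
    next
      assume "\<exists>S. open S \<and> x \<in> S \<and> (\<forall>y\<in>S. y \<noteq> x \<longrightarrow> y \<in> UNIV \<longrightarrow> P y)"
      then obtain N where "open N" "x \<in> N" "\<forall>y\<in>N. y \<noteq> x \<longrightarrow> P y" by blast
      then show "x \<notin> topspace (top_of_set U) \<or>
        (\<exists>N. (open N \<and> N \<subseteq> U) \<and> x \<in> N \<and> (\<forall>y\<in>N - {x}. P y))"
        using x assms by (intro disjI2 exI[of _ "N \<inter> U"]) auto
    qed
  qed
  then show ?thesis unfolding continuous_map_atin by simp
qed

lemma (in seminorm_space) continuous_map_nbhd:
  assumes "open U" "continuous_map (top_of_set U) T g" "x0 \<in> U" "q \<in> CS" "0 < e"
  obtains B where "open B" "x0 \<in> B" "B \<subseteq> U" "\<And>x. x \<in> B \<Longrightarrow> q (g x - g x0) < e"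
proof
  let ?N = "{v \<in> topspace T. q (v - g x0) < e}"
  let ?B = "{x \<in> topspace (top_of_set U). g x \<in> ?N}"
  have g: "g x \<in> topspace T" if "x \<in> U" for x
    using assms(2) that by (auto simp: continuous_map_def)
  have "openin (top_of_set U) ?B"
    by (rule openin_continuous_map_preimage[OF assms(2) openin_ball[OF assms(4) g[OF assms(3)]]])
  then show "open ?B" using openin_open_eq[OF assms(1)] by blast
  show "x0 \<in> ?B" using assms g CS_0[OF assms(4)] by simp
qed auto

subsection \<open>The topology generated by a family of seminorms\<close>

definition seminorm_topology :: "'e::ab_group_add set \<Rightarrow> ('e \<Rightarrow> real) set \<Rightarrow> 'e topology" where
  "seminorm_topology S P = topology_generated_by
     (insert S {{v \<in> S. p (v - u) < r} | u p r. u \<in> S \<and> p \<in> P \<and> 0 < r})"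

locale seminorm_family = seminormed_subspace sc S
  for sc :: "'k::real_normed_field \<Rightarrow> 'e::ab_group_add \<Rightarrow> 'e" and S :: "'e set" +
  fixes P :: "('e \<Rightarrow> real) set"
  assumes seminorm_P: "p \<in> P \<Longrightarrow> seminorm_on sc S p"
    and separating_P: "u \<in> S \<Longrightarrow> (\<And>p. p \<in> P \<Longrightarrow> p u = 0) \<Longrightarrow> u = 0"
begin

lemma topspace_seminorm_topology [simp]: "topspace (seminorm_topology S P) = S"
  unfolding seminorm_topology_def topology_generated_by_topspace by auto

lemma openin_subbasic:
  assumes "u \<in> S" "p \<in> P"
  shows "openin (seminorm_topology S P) {v \<in> S. p (v - u) < r}"
proof (cases "0 < r")
  case True
  then show ?thesis
    unfolding seminorm_topology_def using assms by (intro topology_generated_by_Basis) auto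
next
  case False
  moreover have "0 \<le> p (v - u)" if "v \<in> S" for v
    using that assms subspace_diff[OF subspace_S] by (intro seminorm_on_nonneg[OF seminorm_P]) auto
  ultimately have "{v \<in> S. p (v - u) < r} = {}" by force
  then show ?thesis by (metis openin_empty)
qed

text \<open>
  The balls are only a subbase, around arbitrary centres; the triangle inequality recentres
  them, so finite intersections of concentric balls form a neighbourhood base.
\<close>

lemma openin_seminorm_topology_iff:
  "openin (seminorm_topology S P) N \<longleftrightarrow> N \<subseteq> S \<and>
     (\<forall>u\<in>N. \<exists>Q r. finite Q \<and> Q \<subseteq> P \<and> 0 < r \<and> {v \<in> S. \<forall>p\<in>Q. p (v - u) < r} \<subseteq> N)"
    (is "?L \<longleftrightarrow> ?R N")
proof
  assume ?L
  then have "generate_topology_on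
      (insert S {{v \<in> S. p (v - u) < r} | u p r. u \<in> S \<and> p \<in> P \<and> 0 < r}) N"
    unfolding seminorm_topology_def openin_topology_generated_by_iff .
  then show "?R N"
  proof (induction rule: generate_topology_on.induct)
    case Empty
    show ?case by simp
  next
    case (Int A B)
    show ?case
    proof (intro conjI ballI)
      show "A \<inter> B \<subseteq> S" using Int.IH by blast
      fix u assume u: "u \<in> A \<inter> B"
      obtain Q r where Q: "finite Q" "Q \<subseteq> P" "0 < r" "{v \<in> S. \<forall>p\<in>Q. p (v - u) < r} \<subseteq> A"
        using Int.IH(1) u by blast
      obtain Q' r' where Q': "finite Q'" "Q' \<subseteq> P" "0 < r'" "{v \<in> S. \<forall>p\<in>Q'. p (v - u) < r'} \<subseteq> B"
        using Int.IH(2) u by blast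
      have "{v \<in> S. \<forall>p\<in>Q \<union> Q'. p (v - u) < min r r'} \<subseteq> A \<inter> B" using Q(4) Q'(4) by auto
      then show "\<exists>Q r. finite Q \<and> Q \<subseteq> P \<and> 0 < r \<and> {v \<in> S. \<forall>p\<in>Q. p (v - u) < r} \<subseteq> A \<inter> B"
        using Q Q' by (intro exI[of _ "Q \<union> Q'"] exI[of _ "min r r'"]) auto
    qed
  next
    case (UN K)
    show ?case
    proof (intro conjI ballI)
      show "\<Union>K \<subseteq> S" using UN.IH by blast
      fix u assume "u \<in> \<Union>K"
      then obtain k where k: "k \<in> K" "u \<in> k" by blast
      then obtain Q r where Q: "finite Q" "Q \<subseteq> P" "0 < r" "{v \<in> S. \<forall>p\<in>Q. p (v - u) < r} \<subseteq> k"
        using UN.IH[OF k(1)] by meson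
      with k show "\<exists>Q r. finite Q \<and> Q \<subseteq> P \<and> 0 < r \<and> {v \<in> S. \<forall>p\<in>Q. p (v - u) < r} \<subseteq> \<Union>K"
        by blast
    qed
  next
    case (Basis s)
    then consider "s = S" | u p r where "s = {v \<in> S. p (v - u) < r}" "u \<in> S" "p \<in> P" "0 < r" by blast
    then show ?case
    proof cases
      case 1
      then show ?thesis by (auto intro!: exI[of _ "{}"] exI[of _ "1::real"])
    next
      case (2 u p r)
      show ?thesis
      proof (intro conjI ballI)
        show "s \<subseteq> S" using 2 by blast
        fix w assume w: "w \<in> s"
        have "p (v - u) < r" if v: "v \<in> S" "p (v - w) < r - p (w - u)" for v
          using seminorm_diff_triangle[OF seminorm_P[OF 2(3)] v(1) _ 2(2), of w] v w 2 by auto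
        then have "{v \<in> S. \<forall>p\<in>{p}. p (v - w) < r - p (w - u)} \<subseteq> s" using 2 by auto
        then show "\<exists>Q r. finite Q \<and> Q \<subseteq> P \<and> 0 < r \<and> {v \<in> S. \<forall>p\<in>Q. p (v - w) < r} \<subseteq> s"
          using 2 w by (intro exI[of _ "{p}"] exI[of _ "r - p (w - u)"]) auto
      qed
    qed
  qed
next
  assume R: "?R N"
  show ?L
  proof (subst openin_subopen, intro ballI)
    fix u assume u: "u \<in> N"
    then obtain Q r where Q: "finite Q" "Q \<subseteq> P" "0 < r" "{v \<in> S. \<forall>p\<in>Q. p (v - u) < r} \<subseteq> N"
      using R by blast
    have uS: "u \<in> S" using u R by blast
    have "openin (seminorm_topology S P) (S \<inter> \<Inter>((\<lambda>p. {v \<in> S. p (v - u) < r}) ` Q))"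
    proof (cases "Q = {}")
      case True
      then show ?thesis using openin_topspace[of "seminorm_topology S P"] by simp
    next
      case False
      then show ?thesis
        using Q openin_subbasic[OF uS] openin_topspace[of "seminorm_topology S P"]
        by (intro openin_Int openin_Inter) auto
    qed
    moreover have "S \<inter> \<Inter>((\<lambda>p. {v \<in> S. p (v - u) < r}) ` Q) = {v \<in> S. \<forall>p\<in>Q. p (v - u) < r}"
      by auto
    ultimately have "openin (seminorm_topology S P) {v \<in> S. \<forall>p\<in>Q. p (v - u) < r}"
      by (simp only:)
    moreover have "u \<in> {v \<in> S. \<forall>p\<in>Q. p (v - u) < r}"
    proof -
      have "p (u - u) < r" if "p \<in> Q" for p
        using seminorm_0[OF seminorm_P[OF subsetD[OF Q(2) that]]] Q(3) by simp
      then show ?thesis using uS by simp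
    qed
    ultimately show "\<exists>M. openin (seminorm_topology S P) M \<and> u \<in> M \<and> M \<subseteq> N"
      using Q(4) by (intro exI[of _ "{v \<in> S. \<forall>p\<in>Q. p (v - u) < r}"] conjI)
  qed
qed

lemma openin_dominated_ball:
  assumes q: "seminorm_on sc S q" and Q: "finite Q" "Q \<subseteq> P" "0 \<le> C"
    and dom: "\<And>u. u \<in> S \<Longrightarrow> q u \<le> C * (\<Sum>p\<in>Q. p u)" and u: "u \<in> S"
  shows "openin (seminorm_topology S P) {v \<in> S. q (v - u) < r}"
  unfolding openin_seminorm_topology_iff
proof (intro conjI ballI)
  show "{v \<in> S. q (v - u) < r} \<subseteq> S" by blast
  fix w assume w: "w \<in> {v \<in> S. q (v - u) < r}"
  define d where "d = (r - q (w - u)) / (C * real (card Q) + 1)"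
  have pos: "C * real (card Q) + 1 > 0" using Q by (intro add_nonneg_pos) auto
  have d: "d > 0" unfolding d_def using w pos by (intro divide_pos_pos) auto
  have "q (v - u) < r" if v: "v \<in> S" "\<forall>p\<in>Q. p (v - w) < d" for v
  proof -
    have "q (v - w) \<le> C * (\<Sum>p\<in>Q. p (v - w))"
      using dom v w subspace_diff[OF subspace_S] by blast
    also have "\<dots> \<le> C * (\<Sum>p\<in>Q. d)"
      using v Q by (intro mult_left_mono sum_mono) (auto intro: less_imp_le)
    also have "\<dots> < d * (C * real (card Q) + 1)" using d by (simp add: algebra_simps)
    also have "\<dots> = r - q (w - u)" using pos by (simp add: d_def)
    finally show ?thesis using seminorm_diff_triangle[OF q v(1) _ u, of w] w by auto
  qed
  then show "\<exists>Q r'. finite Q \<and> Q \<subseteq> P \<and> 0 < r' \<and> {v \<in> S. \<forall>p\<in>Q. p (v - w) < r'} \<subseteq> {v \<in> S. q (v - u) < r}"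
    using Q d by (intro exI[of _ Q] exI[of _ d]) auto
qed

lemma dominated_continuous_seminorm:
  assumes q: "seminorm_on sc S q" and Q: "finite Q" "Q \<subseteq> P" "0 \<le> C"
    and dom: "\<And>u. u \<in> S \<Longrightarrow> q u \<le> C * (\<Sum>p\<in>Q. p u)"
  shows "q \<in> continuous_seminorms sc (seminorm_topology S P)"
proof -
  have "continuous_map (seminorm_topology S P) euclideanreal q"
    unfolding continuous_map_def
  proof (intro conjI allI impI)
    show "q \<in> topspace (seminorm_topology S P) \<rightarrow> topspace euclideanreal" by auto
    fix B :: "real set" assume "openin euclideanreal B"
    then have B: "open B" by simp
    show "openin (seminorm_topology S P) {x \<in> topspace (seminorm_topology S P). q x \<in> B}"
    proof (subst openin_subopen, intro ballI)
      fix u assume u: "u \<in> {x \<in> topspace (seminorm_topology S P). q x \<in> B}"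
      then obtain e where e: "e > 0" "\<And>y. dist y (q u) < e \<Longrightarrow> y \<in> B"
        using B unfolding open_dist by auto
      let ?M = "{v \<in> S. q (v - u) < e}"
      have "u \<in> ?M" using u e seminorm_0[OF q] by auto
      moreover have "?M \<subseteq> {x \<in> topspace (seminorm_topology S P). q x \<in> B}"
        using u e(2) seminorm_triangle_diff[OF q] by (force simp: dist_real_def)
      moreover have "openin (seminorm_topology S P) ?M"
        using u by (intro openin_dominated_ball[OF assms]) auto
      ultimately show "\<exists>M. openin (seminorm_topology S P) M \<and> u \<in> M \<and>
          M \<subseteq> {x \<in> topspace (seminorm_topology S P). q x \<in> B}" by blast
    qed
  qed
  then show ?thesis using q by (simp add: continuous_seminorms_iff)
qed

lemma generator_continuous: "p \<in> P \<Longrightarrow> p \<in> continuous_seminorms sc (seminorm_topology S P)"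
  using dominated_continuous_seminorm[of p "{p}" 1] seminorm_P by simp

text \<open>The unit ball of \<open>q\<close> contains a finite intersection of balls of generators around 0, and
  homogeneity turns this inclusion into an inequality.\<close>

lemma continuous_seminorm_dominated:
  assumes "q \<in> continuous_seminorms sc (seminorm_topology S P)"
  obtains Q C where "finite Q" "Q \<subseteq> P" "0 \<le> C" "\<And>u. u \<in> S \<Longrightarrow> q u \<le> C * (\<Sum>p\<in>Q. p u)"
proof -
  have q: "seminorm_on sc S q" and cont: "continuous_map (seminorm_topology S P) euclideanreal q"
    using assms by (auto simp: continuous_seminorms_iff)
  have "openin (seminorm_topology S P) {u \<in> topspace (seminorm_topology S P). q u \<in> {..<1}}"
    using cont by (rule openin_continuous_map_preimage) auto
  moreover have "0 \<in> {u \<in> topspace (seminorm_topology S P). q u \<in> {..<1}}"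
    using seminorm_0[OF q] subspace_0[OF subspace_S] by simp
  ultimately obtain Q r where Q: "finite Q" "Q \<subseteq> P" "0 < r"
      "{v \<in> S. \<forall>p\<in>Q. p (v - 0) < r} \<subseteq> {u \<in> topspace (seminorm_topology S P). q u \<in> {..<1}}"
    unfolding openin_seminorm_topology_iff by meson
  have "q u \<le> (1 / r) * (\<Sum>p\<in>Q. p u)" if u: "u \<in> S" for u
  proof (rule field_le_epsilon)
    fix e :: real assume e: "e > 0"
    define s where "s = (\<Sum>p\<in>Q. p u)"
    define t where "t = s / r + e"
    have s: "s \<ge> 0" unfolding s_def using Q u
      by (intro sum_nonneg seminorm_on_nonneg[OF seminorm_P]) auto
    then have t: "t > 0" unfolding t_def using e Q by (intro add_nonneg_pos) auto
    have "p (sc (of_real (1 / t)) u) < r" if p: "p \<in> Q" for p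
    proof -
      have "p u \<le> s" unfolding s_def using p Q u
        by (intro member_le_sum seminorm_on_nonneg[OF seminorm_P]) auto
      also have "s < r * t" unfolding t_def using Q e by (simp add: algebra_simps)
      finally have "p u < r * t" .
      moreover have "t * p (sc (of_real (1 / t)) u) = p u"
        using seminorm_on_scale[OF seminorm_P[OF subsetD[OF Q(2) p]] u, of "of_real (1/t)"] t
        by (simp add: norm_divide)
      ultimately have "t * p (sc (of_real (1 / t)) u) < t * r" by (simp only: mult.commute)
      then show ?thesis using t by (simp only: mult_less_cancel_left_pos)
    qed
    then have "sc (of_real (1 / t)) u \<in> {v \<in> S. \<forall>p\<in>Q. p (v - 0) < r}"
      using u subspace_scale[OF subspace_S] by auto
    then have "q (sc (of_real (1 / t)) u) < 1" using Q(4) by blast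
    then have "t * q (sc (of_real (1 / t)) u) < t * 1" using t by (intro mult_strict_left_mono)
    moreover have "t * q (sc (of_real (1 / t)) u) = q u"
      using seminorm_on_scale[OF q u, of "of_real (1/t)"] t by (simp add: norm_divide)
    ultimately have "q u < t" by linarith
    then show "q u \<le> (1 / r) * (\<Sum>p\<in>Q. p u) + e" by (simp add: t_def s_def)
  qed
  then show thesis using that[of Q "1 / r"] Q by simp
qed

lemma seminorm_space_seminorm_topology: "seminorm_space sc (seminorm_topology S P)"
proof unfold_locales
  show "subspace (topspace (seminorm_topology S P))" by (simp add: subspace_S)
next
  fix N u assume N: "openin (seminorm_topology S P) N" "u \<in> N"
  then obtain Q r where Q: "finite Q" "Q \<subseteq> P" "0 < r" "{v \<in> S. \<forall>p\<in>Q. p (v - u) < r} \<subseteq> N"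
    and uS: "u \<in> S" unfolding openin_seminorm_topology_iff by blast
  let ?q = "\<lambda>v. (1 / r) * (\<Sum>p\<in>Q. p v)"
  have "?q \<in> continuous_seminorms sc (seminorm_topology S P)"
  proof (rule dominated_continuous_seminorm[where Q = Q and C = "1 / r"])
    show "seminorm_on sc S ?q"
      using Q seminorm_P by (intro seminorm_on_mult_sum[where p = "\<lambda>p. p"]) auto
    show "?q u \<le> (1 / r) * (\<Sum>p\<in>Q. p u)" for u by (rule order_refl)
    show "finite Q" "Q \<subseteq> P" "0 \<le> 1 / r" using Q by simp_all
  qed
  moreover have "{v \<in> topspace (seminorm_topology S P). ?q (v - u) < 1} \<subseteq> N"
  proof
    fix v assume v: "v \<in> {v \<in> topspace (seminorm_topology S P). ?q (v - u) < 1}"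
    have "p (v - u) < r" if "p \<in> Q" for p
    proof -
      have "p (v - u) \<le> (\<Sum>p\<in>Q. p (v - u))"
        using that Q v uS subspace_diff[OF subspace_S] 
        by (intro member_le_sum seminorm_on_nonneg[OF seminorm_P]) auto
      then show ?thesis using v Q by (auto simp: divide_simps)
    qed
    then show "v \<in> N" using Q v by auto
  qed
  ultimately show "\<exists>q\<in>continuous_seminorms sc (seminorm_topology S P).
      {v \<in> topspace (seminorm_topology S P). q (v - u) < 1} \<subseteq> N"
    by (rule bexI[of _ ?q, rotated])
next
  fix q u r assume q: "q \<in> continuous_seminorms sc (seminorm_topology S P)"
    and u: "u \<in> topspace (seminorm_topology S P)"
  obtain Q C where Q: "finite Q" "Q \<subseteq> P" "0 \<le> C" "\<And>u. u \<in> S \<Longrightarrow> q u \<le> C * (\<Sum>p\<in>Q. p u)"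
    using continuous_seminorm_dominated[OF q] by blast
  then show "openin (seminorm_topology S P) {v \<in> topspace (seminorm_topology S P). q (v - u) < r}"
    using q u openin_dominated_ball[of q Q C u r] by (simp add: continuous_seminorms_iff)
next
  fix u assume "u \<in> topspace (seminorm_topology S P)"
    and "\<And>q. q \<in> continuous_seminorms sc (seminorm_topology S P) \<Longrightarrow> q u = 0"
  then show "u = 0" using separating_P generator_continuous by simp
qed

lemma limitin_generators:
  assumes "l \<in> S" "\<forall>\<^sub>F x in F. h x \<in> S"
    and "\<And>p e. p \<in> P \<Longrightarrow> e > 0 \<Longrightarrow> \<forall>\<^sub>F x in F. p (h x - l) < e"
  shows "limitin (seminorm_topology S P) h l F"
  unfolding limitin_def
proof (intro conjI allI impI)
  show "l \<in> topspace (seminorm_topology S P)" using assms by simp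
  fix N assume "openin (seminorm_topology S P) N \<and> l \<in> N"
  then obtain Q r where Q: "finite Q" "Q \<subseteq> P" "0 < r" "{v \<in> S. \<forall>p\<in>Q. p (v - l) < r} \<subseteq> N"
    unfolding openin_seminorm_topology_iff by blast
  have "\<forall>\<^sub>F x in F. \<forall>p\<in>Q. p (h x - l) < r"
    using Q assms(3) by (intro eventually_ball_finite) auto
  then show "\<forall>\<^sub>F x in F. h x \<in> N" using assms(2) by eventually_elim (use Q in auto)
qed

end

subsection \<open>Locally convex spaces\<close>

context locally_convex_space
begin

lemma topspace_scale: "u \<in> topspace T \<Longrightarrow> sc c u \<in> topspace T"
  using subspace_scale[OF subspace_topspace] .

lemma openin_scale_preimage:
  assumes "openin T N"
  shows "openin T {u \<in> topspace T. sc c u \<in> N}"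
proof -
  have "continuous_map T (prod_topology euclidean T) (\<lambda>u. (c, u))"
    by (intro continuous_map_paired[THEN iffD2] conjI continuous_map_const[THEN iffD2]) auto
  then have "continuous_map T T ((\<lambda>(c, u). sc c u) \<circ> (\<lambda>u. (c, u)))"
    using continuous_scale by (rule continuous_map_compose)
  then show ?thesis
    using openin_continuous_map_preimage[OF _ assms] by (simp add: o_def)
qed

lemma openin_diff_preimage:
  assumes "openin T N" "u \<in> topspace T"
  shows "openin T {v \<in> topspace T. v - u \<in> N}"
proof -
  have "- u \<in> topspace T" using assms(2) subspace_neg[OF subspace_topspace] by blast
  then have "continuous_map T (prod_topology T T) (\<lambda>v. (v, - u))"
    by (intro continuous_map_paired[THEN iffD2] conjI continuous_map_const[THEN iffD2]) auto
  then have "continuous_map T T ((\<lambda>(u, v). u + v) \<circ> (\<lambda>v. (v, - u)))"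
    using continuous_add by (rule continuous_map_compose)
  then show ?thesis
    using openin_continuous_map_preimage[OF _ assms(1)] by (simp add: o_def)
qed

lemma openin_scale_image:
  assumes "openin T N" "0 \<in> N" "c \<noteq> 0"
  obtains M where "openin T M" "0 \<in> M" "M \<subseteq> sc c ` N"
proof
  show "openin T {u \<in> topspace T. sc (1 / c) u \<in> N}" using assms by (intro openin_scale_preimage)
  show "0 \<in> {u \<in> topspace T. sc (1 / c) u \<in> N}"
    using assms subspace_0[OF subspace_topspace] by simp
  show "{u \<in> topspace T. sc (1 / c) u \<in> N} \<subseteq> sc c ` N"
    using assms(3) by (auto intro!: image_eqI[where x = "sc (1 / c) _"])
qed

text \<open>
  The balanced core of a convex neighbourhood is again convex, and joint continuity of the scalar
  multiplication at (0, 0) makes it a neighbourhood of 0: after shrinking the vectors by a fixed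
  factor, scalars of norm at most 1 become small scalars.
\<close>

lemma absolutely_convex_nbhd:
  assumes N: "openin T N" "0 \<in> N"
  obtains M D where "openin T M" "0 \<in> M" "M \<subseteq> D" "D \<subseteq> N"
    "\<And>u c. u \<in> D \<Longrightarrow> norm c \<le> 1 \<Longrightarrow> sc c u \<in> D"
    "\<And>u v t. u \<in> D \<Longrightarrow> v \<in> D \<Longrightarrow> 0 \<le> t \<Longrightarrow> t \<le> 1 \<Longrightarrow>
       sc (of_real (1 - t)) u + sc (of_real t) v \<in> D"
proof -
  from locally_convex[OF N] obtain M C where M: "openin T M" "0 \<in> M" "M \<subseteq> C" and C: "C \<subseteq> N"
      "\<forall>u\<in>C. \<forall>v\<in>C. \<forall>t\<in>{0..1::real}. sc (of_real (1 - t)) u + sc (of_real t) v \<in> C"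
    by (elim exE conjE)
  define D where "D = {u \<in> topspace T. \<forall>c. norm c \<le> 1 \<longrightarrow> sc c u \<in> C}"
  define Z where "Z = {z \<in> topspace (prod_topology euclidean T). (\<lambda>(c, u). sc c u) z \<in> M}"
  have "openin (prod_topology euclidean T) Z"
    unfolding Z_def using continuous_scale M(1) by (rule openin_continuous_map_preimage)
  moreover have "(0, 0) \<in> Z"
    using M(2) subspace_0[OF subspace_topspace] by (simp add: Z_def)
  ultimately obtain A B where "openin euclidean A" and A0: "0 \<in> A"
      and B: "openin T B" "0 \<in> B" and AB: "A \<times> B \<subseteq> Z"
    unfolding openin_prod_topology_alt by blast
  then have A: "open A" by simp
  obtain d where d: "d > 0" "\<And>c. norm c < d \<Longrightarrow> c \<in> A"
    using A A0 unfolding open_dist by (auto simp: dist_norm)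
  have "of_real (d / 2) \<noteq> (0::'k)" using d by simp
  then obtain M' where M': "openin T M'" "0 \<in> M'" "M' \<subseteq> sc (of_real (d / 2)) ` B"
    using openin_scale_image[OF B] by metis
  have "M' \<subseteq> D"
  proof
    fix u assume u: "u \<in> M'"
    then obtain b where b: "b \<in> B" "u = sc (of_real (d / 2)) b" using M'(3) by blast
    have "sc c u \<in> C" if "norm c \<le> 1" for c
    proof -
      have "norm (c * of_real (d / 2)) = norm c * (d / 2)"
        using d(1) by (simp add: norm_mult)
      also have "\<dots> < d" using that d(1) mult_right_mono[OF that, of "d / 2"] by simp
      finally have "c * of_real (d / 2) \<in> A" using d(2) by blast
      then have "sc (c * of_real (d / 2)) b \<in> M" using AB b(1) unfolding Z_def by auto
      then show ?thesis using b(2) M(3) by (auto simp: scale_scale)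
    qed
    then show "u \<in> D" using u openin_subset[OF M'(1)] unfolding D_def by blast
  qed
  moreover have "D \<subseteq> N"
  proof
    fix u assume "u \<in> D"
    then have "sc 1 u \<in> C" unfolding D_def by (auto simp del: scale_one)
    then show "u \<in> N" using C(1) by auto
  qed
  moreover have "sc c u \<in> D" if "u \<in> D" "norm c \<le> 1" for u c
  proof -
    have "norm (c' * c) \<le> 1" if "norm c' \<le> 1" for c'
      using that \<open>norm c \<le> 1\<close> by (simp add: norm_mult mult_le_one)
    then show ?thesis using that(1) topspace_scale unfolding D_def by auto
  qed
  moreover have "sc (of_real (1 - t)) u + sc (of_real t) v \<in> D"
    if uv: "u \<in> D" "v \<in> D" and t: "0 \<le> t" "t \<le> 1" for u v and t :: real
  proof -
    have "sc c (sc (of_real (1 - t)) u + sc (of_real t) v) \<in> C" if "norm c \<le> 1" for c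
    proof -
      have "sc c u \<in> C" "sc c v \<in> C" using uv that unfolding D_def by auto
      then have "sc (of_real (1 - t)) (sc c u) + sc (of_real t) (sc c v) \<in> C"
        using C(2)[rule_format, of "sc c u" "sc c v" t] t by simp
      then show ?thesis by (simp add: scale_right_distrib mult.commute)
    qed
    then show ?thesis
      using uv topspace_scale subspace_add[OF subspace_topspace] unfolding D_def by auto
  qed
  ultimately show ?thesis using that[of M' D] M' by blast
qed

text \<open>Minkowski functionals of absolutely convex neighbourhoods provide enough continuous
  seminorms.\<close>

lemma continuous_seminorm_in_nbhd:
  assumes N: "openin T N" "0 \<in> N"
  shows "\<exists>q\<in>continuous_seminorms sc T. {u \<in> topspace T. q u < 1} \<subseteq> N"
proof -
  obtain M D where M: "openin T M" "0 \<in> M" "M \<subseteq> D" and DN: "D \<subseteq> N"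
    and bal: "\<And>u c. u \<in> D \<Longrightarrow> norm c \<le> 1 \<Longrightarrow> sc c u \<in> D"
    and conv: "\<And>u v t. u \<in> D \<Longrightarrow> v \<in> D \<Longrightarrow> 0 \<le> t \<Longrightarrow> t \<le> 1 \<Longrightarrow>
       sc (of_real (1 - t)) u + sc (of_real t) v \<in> D"
    by (rule absolutely_convex_nbhd[OF N], rule that)
  (* the factors by which D has to be dilated in order to contain u *)
  define A where "A u = {s::real. 0 < s \<and> sc (of_real (1 / s)) u \<in> D}" for u
  define q where "q u = Inf (A u)" for u
  have A_bdd: "bdd_below (A u)" for u unfolding A_def by (intro bdd_belowI[of _ 0]) auto
  have A_ne: "A u \<noteq> {}" if u: "u \<in> topspace T" for u
  proof -
    have "continuous_map euclidean (prod_topology euclidean T) (\<lambda>c. (c, u))"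
      using u by (intro continuous_map_paired[THEN iffD2] conjI continuous_map_const[THEN iffD2]) auto
    then have "continuous_map euclidean T ((\<lambda>(c, u). sc c u) \<circ> (\<lambda>c. (c, u)))"
      using continuous_scale by (rule continuous_map_compose)
    from openin_continuous_map_preimage[OF this M(1)] have "open {c. sc c u \<in> M}"
      by (simp add: o_def)
    then obtain d where d: "d > 0" "\<And>c. norm c < d \<Longrightarrow> sc c u \<in> M"
      using M(2) open_dist[THEN iffD1, rule_format, of "{c. sc c u \<in> M}" 0]
      by (auto simp: dist_norm)
    have "2 / d \<in> A u" unfolding A_def using d M(3) by (auto simp: norm_divide)
    then show ?thesis by blast
  qed
  have q_nonneg: "0 \<le> q u" if "u \<in> topspace T" for u
    unfolding q_def using A_ne[OF that] by (intro cInf_greatest) (auto simp: A_def)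
  have q_le: "q u \<le> s" if "s \<in> A u" for u s
    unfolding q_def using that A_bdd by (intro cInf_lower)
  have q_less: "\<exists>s\<in>A u. s < r" if "u \<in> topspace T" "q u < r" for u r
    using that A_ne cInf_lessD unfolding q_def by blast
  have A_mono: "s \<in> A u \<Longrightarrow> s \<le> t \<Longrightarrow> t \<in> A u" for s t u
  proof -
    assume s: "s \<in> A u" "s \<le> t"
    then have pos: "0 < s" "0 < t" unfolding A_def by auto
    have "norm (of_real (s / t) :: 'k) \<le> 1" unfolding norm_of_real using s pos by simp
    moreover have "sc (of_real (1 / s)) u \<in> D" using s(1) by (simp only: A_def mem_Collect_eq)
    ultimately have "sc (of_real (s / t)) (sc (of_real (1 / s)) u) \<in> D" by (rule bal[rotated])
    moreover have "of_real (s / t) * of_real (1 / s) = (of_real (1 / t) :: 'k)"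
      unfolding of_real_mult[symmetric] using pos by (intro arg_cong[where f = of_real]) simp
    ultimately show "t \<in> A u" using pos unfolding A_def scale_scale by simp
  qed
  have in_D: "u \<in> D" if "u \<in> topspace T" "q u < 1" for u
  proof -
    have "1 \<in> A u" using q_less[OF that] A_mono[of _ u 1] by auto
    then show ?thesis unfolding A_def by simp
  qed
  have triangle: "q (u + v) \<le> q u + q v" if u: "u \<in> topspace T" and v: "v \<in> topspace T" for u v
  proof (rule field_le_epsilon)
    fix e :: real assume e: "e > 0"
    obtain s where s: "s \<in> A u" "s < q u + e / 2" using q_less[OF u, of "q u + e / 2"] e by auto
    obtain t where t: "t \<in> A v" "t < q v + e / 2" using q_less[OF v, of "q v + e / 2"] e by auto
    have pos: "0 < s" "0 < t" using s t unfolding A_def by auto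
    have "sc (of_real (1 - t / (s + t))) (sc (of_real (1 / s)) u) +
        sc (of_real (t / (s + t))) (sc (of_real (1 / t)) v) \<in> D"
    proof (rule conv)
      show "sc (of_real (1 / s)) u \<in> D" "sc (of_real (1 / t)) v \<in> D"
        using s(1) t(1) by (simp_all only: A_def mem_Collect_eq)
      show "0 \<le> t / (s + t)" "t / (s + t) \<le> 1" using pos by simp_all
    qed
    moreover have "of_real (1 - t / (s + t)) * of_real (1 / s) = (of_real (1 / (s + t)) :: 'k)"
      unfolding of_real_mult[symmetric] using pos
      by (intro arg_cong[where f = of_real]) (simp add: field_simps)
    moreover have "of_real (t / (s + t)) * of_real (1 / t) = (of_real (1 / (s + t)) :: 'k)"
      unfolding of_real_mult[symmetric] using pos by (intro arg_cong[where f = of_real]) simp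
    ultimately have "sc (of_real (1 / (s + t))) u + sc (of_real (1 / (s + t))) v \<in> D"
      by (simp only: scale_scale)
    then have "s + t \<in> A (u + v)" using pos unfolding A_def by (simp add: scale_right_distrib)
    then show "q (u + v) \<le> q u + q v + e" using q_le[of "s + t" "u + v"] s t by linarith
  qed
  have homog_le: "q (sc c u) \<le> norm c * q u" if u: "u \<in> topspace T" for c u
  proof (rule field_le_epsilon)
    fix e :: real assume e: "e > 0"
    define e' where "e' = e / (norm c + 1)"
    have np: "norm c + 1 > 0" using norm_ge_zero[of c] by linarith
    have e': "e' > 0" unfolding e'_def using e np by simp
    obtain s where s: "s \<in> A u" "s < q u + e'" using q_less[OF u, of "q u + e'"] e' by auto
    have pos: "0 < s" using s unfolding A_def by auto
    show "q (sc c u) \<le> norm c * q u + e"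
    proof (cases "c = 0")
      case True
      have "e \<in> A (0)" unfolding A_def using e M by auto
      then show ?thesis using q_le True by simp
    next
      case False
      have "sc (c / of_real (norm c)) (sc (of_real (1 / s)) u) \<in> D"
      proof (rule bal)
        show "sc (of_real (1 / s)) u \<in> D" using s(1) by (simp only: A_def mem_Collect_eq)
        show "norm (c / of_real (norm c)) \<le> 1" using False by (simp add: norm_divide)
      qed
      then have "norm c * s \<in> A (sc c u)" unfolding A_def using pos False by (simp add: mult.commute)
      then have "q (sc c u) \<le> norm c * s" by (rule q_le)
      also have "\<dots> \<le> norm c * (q u + e')" using s by (intro mult_left_mono) auto
      also have "\<dots> \<le> norm c * q u + (norm c + 1) * e'" using e' by (simp add: algebra_simps)
      also have "(norm c + 1) * e' = e" unfolding e'_def using np by simp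
      finally show ?thesis .
    qed
  qed
  have homog: "q (sc c u) = norm c * q u" if u: "u \<in> topspace T" for c u
  proof (cases "c = 0")
    case True
    then show ?thesis using homog_le[OF u, of 0] q_nonneg[OF topspace_scale[OF u], of 0] by simp
  next
    case False
    have "q (sc (1 / c) (sc c u)) \<le> norm (1 / c) * q (sc c u)"
      using homog_le[OF topspace_scale[OF u]] .
    then have "norm c * q u \<le> q (sc c u)" using False by (simp add: norm_divide field_simps)
    then show ?thesis using homog_le[OF u, of c] by simp
  qed
  have sn: "seminorm_on sc (topspace T) q"
    unfolding seminorm_on_def using q_nonneg triangle homog by blast
  interpret S: seminormed_subspace sc "topspace T" by unfold_locales (rule subspace_topspace)
  have "continuous_map T euclideanreal q"
    unfolding continuous_map_def
  proof (intro conjI allI impI)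
    show "q \<in> topspace T \<rightarrow> topspace euclideanreal" by auto
    fix B :: "real set" assume "openin euclideanreal B"
    then have B: "open B" by simp
    show "openin T {x \<in> topspace T. q x \<in> B}"
    proof (subst openin_subopen, intro ballI)
      fix u assume u: "u \<in> {x \<in> topspace T. q x \<in> B}"
      then obtain e where e: "e > 0" "\<And>y. dist y (q u) < e \<Longrightarrow> y \<in> B"
        using B unfolding open_dist by auto
      have "of_real (e / 2) \<noteq> (0::'k)" using e by simp
      then obtain M' where M': "openin T M'" "0 \<in> M'" "M' \<subseteq> sc (of_real (e / 2)) ` M"
        using openin_scale_image[OF M(1,2)] by metis
      have small: "q v < e" if v: "v \<in> M'" for v
      proof -
        obtain m where "m \<in> M" "v = sc (of_real (e / 2)) m" using M'(3) v by blast
        then have "e / 2 \<in> A v" unfolding A_def using e(1) M(3) by auto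
        then show ?thesis using q_le[of "e / 2" v] e by linarith
      qed
      let ?M = "{v \<in> topspace T. v - u \<in> M'}"
      have "openin T ?M" using M' u by (intro openin_diff_preimage) auto
      moreover have "u \<in> ?M" using u M'(2) by simp
      moreover have "?M \<subseteq> {x \<in> topspace T. q x \<in> B}"
      proof
        fix v assume v: "v \<in> ?M"
        then have "\<bar>q v - q u\<bar> < e"
          using S.seminorm_triangle_diff[OF sn, of v u] small[of "v - u"] u by auto
        then show "v \<in> {x \<in> topspace T. q x \<in> B}" using v e(2) by (auto simp: dist_real_def)
      qed
      ultimately show "\<exists>M. openin T M \<and> u \<in> M \<and> M \<subseteq> {x \<in> topspace T. q x \<in> B}" by blast
    qed
  qed
  then have "q \<in> continuous_seminorms sc T" using sn by (simp add: continuous_seminorms_iff)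
  moreover have "{u \<in> topspace T. q u < 1} \<subseteq> N" using in_D DN by auto
  ultimately show ?thesis by blast
qed

lemma seminorm_space:
  assumes "Hausdorff_space T"
  shows "seminorm_space sc T"
proof unfold_locales
  show "subspace (topspace T)" by (rule subspace_topspace)
next
  fix N u assume N: "openin T N" "u \<in> N"
  then have u: "u \<in> topspace T" using openin_subset by blast
  then have "- u \<in> topspace T" using subspace_neg[OF subspace_topspace] by blast
  then have "openin T {v \<in> topspace T. v - (- u) \<in> N}" by (intro openin_diff_preimage N)
  moreover have "0 \<in> {v \<in> topspace T. v - (- u) \<in> N}"
    using N subspace_0[OF subspace_topspace] by simp
  ultimately obtain q where q: "q \<in> continuous_seminorms sc T"
      "{v \<in> topspace T. q v < 1} \<subseteq> {v \<in> topspace T. v - (- u) \<in> N}"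
    using continuous_seminorm_in_nbhd by meson
  have "{v \<in> topspace T. q (v - u) < 1} \<subseteq> N"
  proof
    fix v assume "v \<in> {v \<in> topspace T. q (v - u) < 1}"
    then have "v - u \<in> {v \<in> topspace T. q v < 1}" using u subspace_diff[OF subspace_topspace] by auto
    then have "v - u \<in> {v \<in> topspace T. v - (- u) \<in> N}" using q(2) by blast
    then show "v \<in> N" by simp
  qed
  then show "\<exists>q\<in>continuous_seminorms sc T. {v \<in> topspace T. q (v - u) < 1} \<subseteq> N" using q by blast
next
  fix q u r assume q: "q \<in> continuous_seminorms sc T" and u: "u \<in> topspace T"
  have "openin T {v \<in> topspace T. q v \<in> {..<r}}"
    using q by (intro openin_continuous_map_preimage) (auto simp: continuous_seminorms_iff)
  then have "openin T {v \<in> topspace T. v - u \<in> {v \<in> topspace T. q v \<in> {..<r}}}"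
    using u by (rule openin_diff_preimage)
  moreover have "{v \<in> topspace T. v - u \<in> {v \<in> topspace T. q v \<in> {..<r}}} =
      {v \<in> topspace T. q (v - u) < r}"
    using u subspace_diff[OF subspace_topspace] by auto
  ultimately show "openin T {v \<in> topspace T. q (v - u) < r}" by simp
next
  fix u assume u: "u \<in> topspace T" and 0: "\<And>q. q \<in> continuous_seminorms sc T \<Longrightarrow> q u = 0"
  show "u = 0"
  proof (rule ccontr)
    assume "u \<noteq> 0"
    then obtain N B where N: "openin T N" "openin T B" "0 \<in> N" "u \<in> B" "disjnt N B"
      using assms u subspace_0[OF subspace_topspace] unfolding Hausdorff_space_def by metis
    then obtain q where q: "q \<in> continuous_seminorms sc T" "{u \<in> topspace T. q u < 1} \<subseteq> N"
      using continuous_seminorm_in_nbhd by blast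
    then have "u \<in> N" using u 0[OF q(1)] by auto
    then show False using N by (auto simp: disjnt_def)
  qed
qed

end

section \<open>Multi-indices as sorted words\<close>

text \<open>
  An iterated partial derivative is taken along a word of coordinates, last letter first, and
  multi-indices correspond to sorted words.  A tail of a sorted word is sorted, which makes
  words the right index set for inductions over the order of differentiation.
\<close>

definition admissible :: "enat \<Rightarrow> 'n::linorder list \<Rightarrow> bool" where
  "admissible k w \<longleftrightarrow> sorted w \<and> enat (length w) \<le> k"

lemma admissible_Nil [simp]: "admissible k []"
  by (simp add: admissible_def zero_enat_def[symmetric])

lemma admissible_ConsD: "admissible k (i # w) \<Longrightarrow> admissible k w"
  unfolding admissible_def by (auto intro: order_trans[rotated])

lemma sorted_concat_replicate:
  "sorted xs \<Longrightarrow> sorted (concat (map (\<lambda>i. replicate (a i) i) xs))"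
  by (induction xs) (auto simp: sorted_append)

lemma count_concat_replicate:
  "distinct xs \<Longrightarrow> count (mset (concat (map (\<lambda>i. replicate (a i) i) xs))) j = (if j \<in> set xs then a j else 0)"
  by (induction xs) auto

lemma admissible_iff_multi_index:
  "admissible k w \<longleftrightarrow> (\<exists>\<alpha>. enat (abs_index \<alpha>) \<le> k \<and> multi_index_word \<alpha> = w)"
proof -
  have srt: "sorted (multi_index_word \<alpha>)" for \<alpha> :: "'n::{finite,linorder} \<Rightarrow> nat"
    unfolding multi_index_word_def by (rule sorted_concat_replicate) simp
  have len: "length (multi_index_word \<alpha>) = abs_index \<alpha>" for \<alpha> :: "'n::{finite,linorder} \<Rightarrow> nat"
    unfolding multi_index_word_def abs_index_def
    by (simp add: length_concat o_def sum_list_distinct_conv_sum_set)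
  have cnt: "count (mset (multi_index_word \<alpha>)) = \<alpha>" for \<alpha> :: "'n::{finite,linorder} \<Rightarrow> nat"
    unfolding multi_index_word_def by (rule ext, subst count_concat_replicate) auto
  have "multi_index_word (count (mset w)) = w" if "sorted w"
  proof -
    have "mset (multi_index_word (count (mset w))) = mset w"
      using cnt[of "count (mset w)"] by (simp add: multiset_eq_iff)
    then show ?thesis
      using properties_for_sort[OF _ srt] properties_for_sort[OF refl that] by metis
  qed
  then show ?thesis
    unfolding admissible_def using srt len by metis
qed

lemma all_multi_index_iff:
  "(\<forall>\<alpha>. enat (abs_index \<alpha>) \<le> k \<longrightarrow> Q (multi_index_word \<alpha>)) \<longleftrightarrow> (\<forall>w. admissible k w \<longrightarrow> Q w)"
  unfolding admissible_iff_multi_index by blast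

lemma Ck_iff:
  "\<gamma> \<in> Ck sc T k U \<longleftrightarrow> (\<forall>x. x \<notin> U \<longrightarrow> \<gamma> x = 0) \<and>
     (\<forall>w. admissible k w \<longrightarrow> iterated_partial_exists sc T U w \<gamma> \<and>
        continuous_map (top_of_set U) T (iterated_partial sc T U w \<gamma>))"
  unfolding Ck_def multi_partial_exists_def multi_partial_def
    all_multi_index_iff[symmetric, where Q = "\<lambda>w. iterated_partial_exists sc T U w \<gamma> \<and>
        continuous_map (top_of_set U) T (iterated_partial sc T U w \<gamma>)"]
  by simp

lemma iterated_partial_outside:
  assumes "\<gamma> \<in> Ck sc T k U" "x \<notin> U"
  shows "iterated_partial sc T U w \<gamma> x = 0"
  using assms by (cases w) (auto simp: Ck_iff partial_derivative_def)

lemma iterated_partial_exists_Ck: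
  "\<gamma> \<in> Ck sc T k U \<Longrightarrow> admissible k w \<Longrightarrow> iterated_partial_exists sc T U w \<gamma>"
  by (simp add: Ck_iff)

lemma continuous_map_iterated_partial:
  "\<gamma> \<in> Ck sc T k U \<Longrightarrow> admissible k w \<Longrightarrow>
     continuous_map (top_of_set U) T (iterated_partial sc T U w \<gamma>)"
  by (simp add: Ck_iff)

section \<open>Linearity of iterated partial derivatives\<close>

lemma vector_space_fun_scale: "vector_space sc \<Longrightarrow> vector_space (fun_scale sc)"
  unfolding vector_space_def fun_scale_def by (auto simp: fun_eq_iff)

context seminorm_space
begin

lemma limitin_add:
  assumes "limitin T h l F" "limitin T h' l' F"
  shows "limitin T (\<lambda>x. h x + h' x) (l + l') F"
  unfolding limitin_seminorm_iff
proof (intro conjI ballI allI impI)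
  have l: "l \<in> topspace T" "l' \<in> topspace T" using assms by (auto simp: limitin_def)
  then show "l + l' \<in> topspace T" using subspace_add[OF subspace_S] by blast
  fix q and e :: real assume q: "q \<in> CS" and e: "e > 0"
  show "\<forall>\<^sub>F x in F. h x + h' x \<in> topspace T \<and> q (h x + h' x - (l + l')) < e"
    using limitin_seminormD[OF assms(1) q half_gt_zero[OF e]]
      limitin_seminormD[OF assms(2) q half_gt_zero[OF e]]
  proof eventually_elim
    case (elim x)
    have "q ((h x - l) + (h' x - l')) \<le> q (h x - l) + q (h' x - l')"
      using elim l subspace_diff[OF subspace_S] by (intro CS_triangle[OF q]) auto
    then have "q (h x + h' x - (l + l')) < e" using elim by (simp add: algebra_simps)
    then show ?case using elim subspace_add[OF subspace_S] by blast
  qed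
qed

lemma limitin_scale:
  assumes "limitin T h l F"
  shows "limitin T (\<lambda>x. sc c (h x)) (sc c l) F"
  unfolding limitin_seminorm_iff
proof (intro conjI ballI allI impI)
  have l: "l \<in> topspace T" using assms by (auto simp: limitin_def)
  then show "sc c l \<in> topspace T" using subspace_scale[OF subspace_S] by blast
  fix q and e :: real assume q: "q \<in> CS" and e: "e > 0"
  have np: "norm c + 1 > 0" using norm_ge_zero[of c] by linarith
  then have "e / (norm c + 1) > 0" using e by simp
  from limitin_seminormD[OF assms q this]
  show "\<forall>\<^sub>F x in F. sc c (h x) \<in> topspace T \<and> q (sc c (h x) - sc c l) < e"
  proof eventually_elim
    case (elim x)
    have d: "h x - l \<in> topspace T" using elim l subspace_diff[OF subspace_S] by auto
    have "q (sc c (h x) - sc c l) = norm c * q (h x - l)"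
      using CS_scale[OF q d] by (simp add: scale_right_diff_distrib)
    also have "\<dots> \<le> (norm c + 1) * q (h x - l)"
      using CS_nonneg[OF q d] by (simp add: algebra_simps)
    also have "\<dots> < e" using elim np by (simp add: field_simps)
    finally show ?case using elim subspace_scale[OF subspace_S] by blast
  qed
qed

lemma partial_derivative_eqI:
  assumes "x \<in> U" "has_partial_derivative sc T i \<gamma> x d"
  shows "partial_derivative sc T U i \<gamma> x = d"
  unfolding partial_derivative_def
  using assms limitin_unique[of _ d "at (0::real)"]
  by (auto simp: has_partial_derivative_def intro!: the_equality limitin_unique)

lemma has_partial_derivative_Cons:
  assumes "iterated_partial_exists sc T U (i # w) \<gamma>" "x \<in> U"
  shows "has_partial_derivative sc T i (iterated_partial sc T U w \<gamma>) x
    (iterated_partial sc T U (i # w) \<gamma> x)"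
  using assms partial_derivative_eqI by fastforce

text \<open>Uniqueness of limits identifies the derivatives one letter at a time; existence and value of the
  derivatives of sums, multiples and slices are obtained together from this.\<close>

lemma iterated_partial_family:
  assumes "admissible k w"
    and zero: "\<And>w x. admissible k w \<Longrightarrow> x \<notin> U \<Longrightarrow> H w x = 0"
    and der: "\<And>i w x. admissible k (i # w) \<Longrightarrow> x \<in> U \<Longrightarrow>
      has_partial_derivative sc T i (H w) x (H (i # w) x)"
  shows "iterated_partial_exists sc T U w (H []) \<and> iterated_partial sc T U w (H []) = H w"
  using assms(1)
proof (induction w)
  case Nil
  show ?case by simp
next
  case (Cons i w)
  then have IH: "iterated_partial_exists sc T U w (H [])" "iterated_partial sc T U w (H []) = H w"
    using admissible_ConsD by blast+
  have "partial_derivative sc T U i (H w) x = H (i # w) x" for x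
    using partial_derivative_eqI[OF _ der[OF Cons.prems]] zero[OF Cons.prems]
    by (cases "x \<in> U") (auto simp: partial_derivative_def)
  then show ?case using IH der[OF Cons.prems] by auto
qed

lemma iterated_partial_add:
  fixes U :: "(real^'n::{finite,linorder}) set"
  assumes "\<gamma> \<in> Ck sc T k U" "\<eta> \<in> Ck sc T k U" "admissible k w"
  shows "iterated_partial_exists sc T U w (\<gamma> + \<eta>) \<and> iterated_partial sc T U w (\<gamma> + \<eta>) =
    iterated_partial sc T U w \<gamma> + iterated_partial sc T U w \<eta>"
proof -
  let ?H = "\<lambda>w::'n list. iterated_partial sc T U w \<gamma> + iterated_partial sc T U w \<eta>"
  have "iterated_partial_exists sc T U w (?H []) \<and> iterated_partial sc T U w (?H []) = ?H w"
  proof (rule iterated_partial_family[OF assms(3)])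
    fix w :: "'n list" and x assume "x \<notin> U"
    then show "?H w x = 0" using assms by (simp add: iterated_partial_outside)
  next
    fix i :: 'n and w x assume w: "admissible k (i # w)" and x: "x \<in> U"
    show "has_partial_derivative sc T i (?H w) x (?H (i # w) x)"
      using limitin_add[OF
          has_partial_derivative_Cons[OF iterated_partial_exists_Ck[OF assms(1) w] x,
            unfolded has_partial_derivative_def]
          has_partial_derivative_Cons[OF iterated_partial_exists_Ck[OF assms(2) w] x,
            unfolded has_partial_derivative_def]]
      unfolding has_partial_derivative_def
      by (simp add: add_diff_add scale_right_distrib del: iterated_partial.simps)
  qed
  then show ?thesis by simp
qed

lemma iterated_partial_scale:
  fixes U :: "(real^'n::{finite,linorder}) set"
  assumes "\<gamma> \<in> Ck sc T k U" "admissible k w"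
  shows "iterated_partial_exists sc T U w (fun_scale sc c \<gamma>) \<and>
    iterated_partial sc T U w (fun_scale sc c \<gamma>) = fun_scale sc c (iterated_partial sc T U w \<gamma>)"
proof -
  let ?H = "\<lambda>w::'n list. fun_scale sc c (iterated_partial sc T U w \<gamma>)"
  have "iterated_partial_exists sc T U w (?H []) \<and> iterated_partial sc T U w (?H []) = ?H w"
  proof (rule iterated_partial_family[OF assms(2)])
    fix w :: "'n list" and x assume "x \<notin> U"
    then show "?H w x = 0" using assms by (simp add: iterated_partial_outside fun_scale_def)
  next
    fix i :: 'n and w x assume w: "admissible k (i # w)" and x: "x \<in> U"
    show "has_partial_derivative sc T i (?H w) x (?H (i # w) x)"
      using limitin_scale[OF
          has_partial_derivative_Cons[OF iterated_partial_exists_Ck[OF assms(1) w] x,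
            unfolded has_partial_derivative_def], of c]
      unfolding has_partial_derivative_def fun_scale_def
      by (simp add: scale_right_diff_distrib[symmetric] mult.commute del: iterated_partial.simps)
  qed
  then show ?thesis by simp
qed

lemma continuous_map_add_T:
  assumes "open U" "continuous_map (top_of_set U) T g" "continuous_map (top_of_set U) T h"
  shows "continuous_map (top_of_set U) T (g + h)"
  using assms by (simp add: continuous_map_open_iff_limitin limitin_add plus_fun_def)

lemma continuous_map_scale_T:
  assumes "open U" "continuous_map (top_of_set U) T g"
  shows "continuous_map (top_of_set U) T (fun_scale sc c g)"
  using assms by (simp add: continuous_map_open_iff_limitin limitin_scale fun_scale_def)

end

section \<open>Weighted function spaces\<close>

text \<open>This is the supremum only where the supremum is finite, as on the weighted space; elsewhere
  \<open>enn2real\<close> gives 0.\<close>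

definition weighted_norm ::
    "('k::real_normed_field \<Rightarrow> 'e::ab_group_add \<Rightarrow> 'e) \<Rightarrow> 'e topology \<Rightarrow>
     (real^'n::{finite,linorder}) set \<Rightarrow> (real^'n::{finite,linorder} \<Rightarrow> real) \<Rightarrow> 'n list \<Rightarrow>
     ('e \<Rightarrow> real) \<Rightarrow> (real^'n::{finite,linorder} \<Rightarrow> 'e) \<Rightarrow> real" where
  "weighted_norm sc T U f w q \<gamma> = 
     enn2real (SUP x\<in>U. ennreal (f x * q (iterated_partial sc T U w \<gamma> x)))"

lemma SUP_ennreal_finite_iff:
  "(SUP x\<in>U. ennreal (g x)) < \<infinity> \<longleftrightarrow> (\<exists>C. \<forall>x\<in>U. g x \<le> C)" (is "?S < \<infinity> \<longleftrightarrow> _")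
proof
  assume "?S < \<infinity>"
  then have "ennreal (g x) \<le> ennreal (enn2real ?S)" if "x \<in> U" for x
    using that by (auto simp: ennreal_enn2real less_top[symmetric] intro: SUP_upper)
  then have "\<forall>x\<in>U. g x \<le> enn2real ?S" by simp
  then show "\<exists>C. \<forall>x\<in>U. g x \<le> C" by blast
next
  assume "\<exists>C. \<forall>x\<in>U. g x \<le> C"
  then obtain C where "\<forall>x\<in>U. g x \<le> C" by blast
  then have "?S \<le> ennreal C" by (intro SUP_least ennreal_leI) auto
  also have "\<dots> < \<infinity>" by simp
  finally show "?S < \<infinity>" .
qed

lemma weighted_Ck_iff:
  "\<gamma> \<in> weighted_Ck sc T k W U \<longleftrightarrow> \<gamma> \<in> Ck sc T k U \<and>
     (\<forall>f\<in>W. \<forall>q\<in>continuous_seminorms sc T. \<forall>w. admissible k w \<longrightarrow>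
       (\<exists>C. \<forall>x\<in>U. f x * q (iterated_partial sc T U w \<gamma> x) \<le> C))"
proof -
  have "(\<forall>\<alpha>. enat (abs_index \<alpha>) \<le> k \<longrightarrow>
        (\<exists>C. \<forall>x\<in>U. f x * q (iterated_partial sc T U (multi_index_word \<alpha>) \<gamma> x) \<le> C)) \<longleftrightarrow>
      (\<forall>w. admissible k w \<longrightarrow> (\<exists>C. \<forall>x\<in>U. f x * q (iterated_partial sc T U w \<gamma> x) \<le> C))"
    for f :: "_ \<Rightarrow> real" and q
    by (rule all_multi_index_iff)
  then show ?thesis
    unfolding weighted_Ck_def weighted_seminorm_def multi_partial_def SUP_ennreal_finite_iff by simp
qed

lemma weighted_norm_nonneg [simp]: "0 \<le> weighted_norm sc T U f w q \<gamma>"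
  by (simp add: weighted_norm_def)

lemma weighted_norm_leI:
  "0 \<le> C \<Longrightarrow> (\<And>x. x \<in> U \<Longrightarrow> f x * q (iterated_partial sc T U w \<gamma> x) \<le> C) \<Longrightarrow>
    weighted_norm sc T U f w q \<gamma> \<le> C"
  unfolding weighted_norm_def by (intro enn2real_leI SUP_least ennreal_leI) auto

lemma weighted_norm_upper:
  assumes "\<gamma> \<in> weighted_Ck sc T k W U" "f \<in> W" "q \<in> continuous_seminorms sc T" "admissible k w"
    "x \<in> U"
  shows "f x * q (iterated_partial sc T U w \<gamma> x) \<le> weighted_norm sc T U f w q \<gamma>"
proof -
  let ?S = "SUP x\<in>U. ennreal (f x * q (iterated_partial sc T U w \<gamma> x))"
  have "?S < \<infinity>" using assms unfolding SUP_ennreal_finite_iff weighted_Ck_iff by blast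
  then have "ennreal (f x * q (iterated_partial sc T U w \<gamma> x)) \<le> ennreal (enn2real ?S)"
    using assms by (auto simp: ennreal_enn2real less_top[symmetric] intro: SUP_upper)
  then show ?thesis unfolding weighted_norm_def by simp
qed

definition weighted_norms ::
    "('k::real_normed_field \<Rightarrow> 'e::ab_group_add \<Rightarrow> 'e) \<Rightarrow> 'e topology \<Rightarrow> enat \<Rightarrow>
     (real^'n::{finite,linorder} \<Rightarrow> real) set \<Rightarrow> (real^'n::{finite,linorder}) set \<Rightarrow>
     ((real^'n::{finite,linorder} \<Rightarrow> 'e) \<Rightarrow> real) set" where
  "weighted_norms sc T k W U = {weighted_norm sc T U f w q | f w q.
     f \<in> W \<and> admissible k w \<and> q \<in> continuous_seminorms sc T}"

text \<open>A continuous weight that is positive at a point is bounded below by a positive constant near it;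
  this is how weighted bounds control values locally.\<close>

locale weighted_space = seminorm_space sc T
  for sc :: "'k::real_normed_field \<Rightarrow> 'e::ab_group_add \<Rightarrow> 'e" and T :: "'e topology" +
  fixes k :: enat and U :: "(real^'n::{finite,linorder}) set" and W :: "(real^'n::{finite,linorder} \<Rightarrow> real) set"
  assumes open_U: "open U" and weights: "set_of_weights U W"
    and continuous_weight: "f \<in> W \<Longrightarrow> continuous_on U f"
begin

abbreviation "S \<equiv> weighted_Ck sc T k W U"
abbreviation "F \<equiv> weighted_Ck_topology sc T k W U"
abbreviation "D \<equiv> iterated_partial sc T U"
abbreviation "N \<equiv> weighted_norm sc T U"

lemma weight_nonneg: "f \<in> W \<Longrightarrow> x \<in> U \<Longrightarrow> 0 \<le> f x"
  using weights unfolding set_of_weights_def by blast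

lemma weight_pos: "x \<in> U \<Longrightarrow> \<exists>f\<in>W. 0 < f x"
  using weights unfolding set_of_weights_def by blast

lemma S_Ck: "\<gamma> \<in> S \<Longrightarrow> \<gamma> \<in> Ck sc T k U"
  by (simp add: weighted_Ck_iff)

lemma D_topspace: "\<gamma> \<in> Ck sc T k U \<Longrightarrow> admissible k w \<Longrightarrow> D w \<gamma> x \<in> topspace T"
  using continuous_map_iterated_partial[of \<gamma> sc T k U w] iterated_partial_outside[of \<gamma> sc T k U x w]
    subspace_0[OF subspace_S]
  by (cases "x \<in> U") (auto simp: continuous_map_def)

lemma Ck_add: "\<gamma> \<in> Ck sc T k U \<Longrightarrow> \<eta> \<in> Ck sc T k U \<Longrightarrow> \<gamma> + \<eta> \<in> Ck sc T k U"
  unfolding Ck_iff[of "\<gamma> + \<eta>"]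
proof (intro conjI allI impI)
  assume g: "\<gamma> \<in> Ck sc T k U" "\<eta> \<in> Ck sc T k U"
  fix x assume "x \<notin> U"
  then show "(\<gamma> + \<eta>) x = 0" using g by (simp add: Ck_iff)
next
  fix w :: "'n list" assume g: "\<gamma> \<in> Ck sc T k U" "\<eta> \<in> Ck sc T k U" and w: "admissible k w"
  show "iterated_partial_exists sc T U w (\<gamma> + \<eta>)"
    "continuous_map (top_of_set U) T (D w (\<gamma> + \<eta>))"
    using iterated_partial_add[OF g w]
      continuous_map_add_T[OF open_U continuous_map_iterated_partial[OF g(1) w]
        continuous_map_iterated_partial[OF g(2) w]] by simp_all
qed

lemma Ck_scale: "\<gamma> \<in> Ck sc T k U \<Longrightarrow> fun_scale sc c \<gamma> \<in> Ck sc T k U"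
  unfolding Ck_iff[of "fun_scale sc c \<gamma>"]
proof (intro conjI allI impI)
  assume g: "\<gamma> \<in> Ck sc T k U"
  fix x assume "x \<notin> U"
  then show "fun_scale sc c \<gamma> x = 0" using g by (simp add: Ck_iff fun_scale_def)
next
  fix w :: "'n list" assume g: "\<gamma> \<in> Ck sc T k U" and w: "admissible k w"
  show "iterated_partial_exists sc T U w (fun_scale sc c \<gamma>)"
    "continuous_map (top_of_set U) T (D w (fun_scale sc c \<gamma>))"
    using iterated_partial_scale[OF g w]
      continuous_map_scale_T[OF open_U continuous_map_iterated_partial[OF g w]] by simp_all
qed

lemma D_add: "\<gamma> \<in> S \<Longrightarrow> \<eta> \<in> S \<Longrightarrow> admissible k w \<Longrightarrow> D w (\<gamma> + \<eta>) x = D w \<gamma> x + D w \<eta> x"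
  using iterated_partial_add[OF S_Ck S_Ck] by simp

lemma D_scale: "\<gamma> \<in> S \<Longrightarrow> admissible k w \<Longrightarrow> D w (fun_scale sc c \<gamma>) x = sc c (D w \<gamma> x)"
  using iterated_partial_scale[OF S_Ck] by (simp add: fun_scale_def)

lemma S_add:
  assumes "\<gamma> \<in> S" "\<eta> \<in> S"
  shows "\<gamma> + \<eta> \<in> S"
  unfolding weighted_Ck_iff
proof (intro conjI ballI allI impI)
  show "\<gamma> + \<eta> \<in> Ck sc T k U" using assms by (intro Ck_add S_Ck)
  fix f q and w :: "'n list" assume *: "f \<in> W" "q \<in> CS" "admissible k w"
  have "f x * q (D w (\<gamma> + \<eta>) x) \<le> N f w q \<gamma> + N f w q \<eta>" if x: "x \<in> U" for x
  proof -
    have "f x * q (D w (\<gamma> + \<eta>) x) \<le> f x * (q (D w \<gamma> x) + q (D w \<eta> x))"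
      using * x assms by (simp add: D_add mult_left_mono weight_nonneg CS_triangle D_topspace S_Ck)
    then show ?thesis
      using weighted_norm_upper[OF assms(1) * x] weighted_norm_upper[OF assms(2) * x]
      by (simp add: distrib_left)
  qed
  then show "\<exists>C. \<forall>x\<in>U. f x * q (D w (\<gamma> + \<eta>) x) \<le> C" by blast
qed

lemma S_scale:
  assumes "\<gamma> \<in> S"
  shows "fun_scale sc c \<gamma> \<in> S"
  unfolding weighted_Ck_iff
proof (intro conjI ballI allI impI)
  show "fun_scale sc c \<gamma> \<in> Ck sc T k U" using assms by (intro Ck_scale S_Ck)
  fix f q and w :: "'n list" assume *: "f \<in> W" "q \<in> CS" "admissible k w"
  have "f x * q (D w (fun_scale sc c \<gamma>) x) \<le> norm c * N f w q \<gamma>" if x: "x \<in> U" for x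
    using weighted_norm_upper[OF assms * x] *(3) assms CS_scale[OF *(2) D_topspace[OF S_Ck[OF assms] *(3)]]
      mult_left_mono[OF weighted_norm_upper[OF assms * x] norm_ge_zero[of c]]
    by (simp add: D_scale algebra_simps)
  then show "\<exists>C. \<forall>x\<in>U. f x * q (D w (fun_scale sc c \<gamma>) x) \<le> C" by blast
qed

lemma vector_space_functions: "vector_space (fun_scale sc)"
  by (rule vector_space_fun_scale) unfold_locales

lemma zero_S: "0 \<in> S"
proof -
  let ?H = "\<lambda>w::'n list. (0 :: (real, 'n) vec \<Rightarrow> 'e)"
  have "iterated_partial_exists sc T U w (?H []) \<and> D w (?H []) = ?H w"
    if "admissible k w" for w
  proof (rule iterated_partial_family[OF that])
    fix i :: 'n and w x assume "x \<in> U"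
    show "has_partial_derivative sc T i (?H w) x (?H (i # w) x)"
      unfolding has_partial_derivative_def
      using subspace_0[OF subspace_S] by (simp add: limitin_def)
  qed simp
  then have "0 \<in> Ck sc T k U" and "admissible k w \<Longrightarrow> D w 0 = 0" for w
    unfolding Ck_iff using subspace_0[OF subspace_S] by (auto simp: zero_fun_def)
  then show ?thesis
    unfolding weighted_Ck_iff by (metis CS_0 mult_zero_right order_refl zero_fun_apply)
qed

sublocale fun_space: seminormed_subspace "fun_scale sc" S
proof -
  interpret V: vector_space "fun_scale sc" by (rule vector_space_functions)
  show "seminormed_subspace (fun_scale sc) S"
    by unfold_locales (intro V.subspaceI zero_S S_add S_scale)
qed

lemma S_diff: "\<gamma> \<in> S \<Longrightarrow> \<eta> \<in> S \<Longrightarrow> \<gamma> - \<eta> \<in> S"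
  by (rule fun_space.subspace_diff[OF fun_space.subspace_S])

lemma D_diff:
  assumes "\<gamma> \<in> S" "\<eta> \<in> S" "admissible k w"
  shows "D w (\<gamma> - \<eta>) x = D w \<gamma> x - D w \<eta> x"
proof -
  have "D w ((\<gamma> - \<eta>) + \<eta>) x = D w (\<gamma> - \<eta>) x + D w \<eta> x"
    using assms S_diff by (intro D_add)
  then show ?thesis by simp
qed

lemma seminorm_on_N:
  assumes "f \<in> W" "admissible k w" "q \<in> CS"
  shows "seminorm_on (fun_scale sc) S (N f w q)"
proof -
  note U = weighted_norm_upper[OF _ assms(1,3,2)]
  have le: "N f w q (fun_scale sc c \<gamma>) \<le> norm c * N f w q \<gamma>" if "\<gamma> \<in> S" for c \<gamma>
  proof (rule weighted_norm_leI)
    fix x assume x: "x \<in> U"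
    show "f x * q (D w (fun_scale sc c \<gamma>) x) \<le> norm c * N f w q \<gamma>"
      using assms that CS_scale[OF assms(3) D_topspace[OF S_Ck[OF that] assms(2)]]
        mult_left_mono[OF U[OF that x] norm_ge_zero[of c]]
      by (simp add: D_scale algebra_simps)
  qed simp
  show ?thesis
    unfolding seminorm_on_def
  proof (intro conjI ballI allI)
    fix \<gamma> \<eta> assume g: "\<gamma> \<in> S" "\<eta> \<in> S"
    show "N f w q (\<gamma> + \<eta>) \<le> N f w q \<gamma> + N f w q \<eta>"
    proof (rule weighted_norm_leI)
      fix x assume x: "x \<in> U"
      have "f x * q (D w (\<gamma> + \<eta>) x) \<le> f x * (q (D w \<gamma> x) + q (D w \<eta> x))"
        using assms x g by (simp add: D_add mult_left_mono weight_nonneg CS_triangle D_topspace S_Ck)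
      then show "f x * q (D w (\<gamma> + \<eta>) x) \<le> N f w q \<gamma> + N f w q \<eta>"
        using U[OF g(1) x] U[OF g(2) x] by (simp add: distrib_left)
    qed simp
  next
    fix c \<gamma> assume g: "\<gamma> \<in> S"
    show "N f w q (fun_scale sc c \<gamma>) = norm c * N f w q \<gamma>"
    proof (cases "c = 0")
      case True
      have "N f w q (fun_scale sc 0 \<gamma>) \<le> 0" using le[OF g, of 0] by (simp only: norm_zero mult_zero_left)
      then have "N f w q (fun_scale sc 0 \<gamma>) = 0" using weighted_norm_nonneg by (rule antisym)
      then show ?thesis by (simp only: True norm_zero mult_zero_left)
    next
      case False
      (* the reverse inequality is the first one for the scalar 1 / c *)
      have "fun_scale sc (1 / c) (fun_scale sc c \<gamma>) = \<gamma>"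
        using False by (simp add: fun_scale_def)
      then have "N f w q \<gamma> \<le> norm (1 / c) * N f w q (fun_scale sc c \<gamma>)"
        using le[OF S_scale[OF g, of c], of "1 / c"] by simp
      then have "norm c * N f w q \<gamma> \<le> N f w q (fun_scale sc c \<gamma>)"
        using False by (simp add: norm_divide field_simps)
      then show ?thesis using le[OF g, of c] by simp
    qed
  qed simp
qed

sublocale fun_space: seminorm_family "fun_scale sc" S "weighted_norms sc T k W U"
proof unfold_locales
  fix p assume "p \<in> weighted_norms sc T k W U"
  then show "seminorm_on (fun_scale sc) S p" unfolding weighted_norms_def using seminorm_on_N by blast
next
  fix \<gamma> assume g: "\<gamma> \<in> S" and 0: "\<And>p. p \<in> weighted_norms sc T k W U \<Longrightarrow> p \<gamma> = 0"
  have "\<gamma> x = 0" for x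
  proof (cases "x \<in> U")
    case x: True
    then obtain f where f: "f \<in> W" "0 < f x" using weight_pos by blast
    show ?thesis
    proof (rule separating)
      show tx: "\<gamma> x \<in> topspace T" using D_topspace[OF S_Ck[OF g], of "[]"] by simp
      fix q assume q: "q \<in> CS"
      have "f x * q (D [] \<gamma> x) \<le> N f [] q \<gamma>"
        using g f q x by (intro weighted_norm_upper) auto
      also have "\<dots> = 0" using f q admissible_Nil by (intro 0) (unfold weighted_norms_def, blast)
      finally show "q (\<gamma> x) = 0" using f CS_nonneg[OF q tx] by (simp add: mult_le_0_iff)
    qed
  next
    case False
    then show ?thesis using S_Ck[OF g] by (simp add: Ck_iff)
  qed
  then show "\<gamma> = 0" by auto
qed

text \<open>On differences of elements of \<open>S\<close> the suprema in \<open>[0, \<infinity>]\<close> are finite, so the given subbase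
  consists of balls of real-valued seminorms.\<close>

lemma F_eq: "F = seminorm_topology S (weighted_norms sc T k W U)"
proof -
  have *: "{\<eta> \<in> S. weighted_seminorm sc T U f \<alpha> q (\<eta> - \<gamma>) < ennreal r} =
      {\<eta> \<in> S. N f (multi_index_word \<alpha>) q (\<eta> - \<gamma>) < r}"
    if g: "\<gamma> \<in> S" and f: "f \<in> W" and a: "enat (abs_index \<alpha>) \<le> k" and q: "q \<in> CS" and r: "0 < r"
    for \<gamma> f \<alpha> q r
  proof (rule Collect_cong, rule conj_cong, rule refl)
    fix \<eta> assume "\<eta> \<in> S"
    then have "\<eta> - \<gamma> \<in> S" using g by (intro S_diff)
    then have "weighted_seminorm sc T U f \<alpha> q (\<eta> - \<gamma>) < \<infinity>"
      using f a q unfolding weighted_Ck_def by blast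
    then have "weighted_seminorm sc T U f \<alpha> q (\<eta> - \<gamma>) = ennreal (N f (multi_index_word \<alpha>) q (\<eta> - \<gamma>))"
      unfolding weighted_norm_def weighted_seminorm_def multi_partial_def
      by (simp add: ennreal_enn2real less_top[symmetric])
    then show "weighted_seminorm sc T U f \<alpha> q (\<eta> - \<gamma>) < ennreal r \<longleftrightarrow>
        N f (multi_index_word \<alpha>) q (\<eta> - \<gamma>) < r"
      using r by (simp add: ennreal_less_iff)
  qed
  have "{{\<eta> \<in> S. weighted_seminorm sc T U f \<alpha> q (\<eta> - \<gamma>) < ennreal r} | \<gamma> f \<alpha> q r.
        \<gamma> \<in> S \<and> f \<in> W \<and> enat (abs_index \<alpha>) \<le> k \<and> q \<in> CS \<and> 0 < r} =
     {{v \<in> S. p (v - u) < r} | u p r. u \<in> S \<and> p \<in> weighted_norms sc T k W U \<and> 0 < r}"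
    (is "?L = ?R")
  proof
    show "?L \<subseteq> ?R"
    proof
      fix B assume "B \<in> ?L"
      then obtain \<gamma> f \<alpha> q r where B: "B = {\<eta> \<in> S. weighted_seminorm sc T U f \<alpha> q (\<eta> - \<gamma>) < ennreal r}"
        and a: "\<gamma> \<in> S" "f \<in> W" "enat (abs_index \<alpha>) \<le> k" "q \<in> CS" "0 < r" by blast
      have "N f (multi_index_word \<alpha>) q \<in> weighted_norms sc T k W U"
        unfolding weighted_norms_def admissible_iff_multi_index using a by blast
      then show "B \<in> ?R" unfolding B *[OF a] using a by blast
    qed
    show "?R \<subseteq> ?L"
    proof
      fix B assume "B \<in> ?R"
      then obtain \<gamma> f w q r where B: "B = {v \<in> S. N f w q (v - \<gamma>) < r}"
        and a: "\<gamma> \<in> S" "f \<in> W" "admissible k w" "q \<in> CS" "0 < r"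
        unfolding weighted_norms_def by blast
      obtain \<alpha> where al: "enat (abs_index \<alpha>) \<le> k" "multi_index_word \<alpha> = w"
        using a(3) unfolding admissible_iff_multi_index by blast
      have "B = {\<eta> \<in> S. weighted_seminorm sc T U f \<alpha> q (\<eta> - \<gamma>) < ennreal r}"
        unfolding B *[OF a(1,2) al(1) a(4,5)] al(2) ..
      then show "B \<in> ?L" using a al by blast
    qed
  qed
  then show ?thesis unfolding weighted_Ck_topology_def seminorm_topology_def by simp
qed

sublocale fun_space: seminorm_space "fun_scale sc" F
  unfolding F_eq by (rule fun_space.seminorm_space_seminorm_topology)

lemma N_CS: "f \<in> W \<Longrightarrow> admissible k w \<Longrightarrow> q \<in> CS \<Longrightarrow> N f w q \<in> fun_space.CS"
  unfolding F_eq by (rule fun_space.generator_continuous) (auto simp: weighted_norms_def)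

lemma D_zero: "admissible k w \<Longrightarrow> D w 0 x = 0"
  using D_diff[OF zero_S zero_S] by simp

text \<open>A weight that is positive at \<open>x\<close> makes evaluation at \<open>x\<close> continuous.\<close>

lemma limitin_evaluation:
  assumes "limitin F h l G" "admissible k w" "x \<in> U"
  shows "limitin T (\<lambda>z. D w (h z) x) (D w l x) G"
  unfolding limitin_seminorm_iff
proof (intro conjI ballI allI impI)
  have l: "l \<in> S" using assms(1) by (simp add: limitin_def)
  then show "D w l x \<in> topspace T" using D_topspace S_Ck assms(2) by blast
  fix q and e :: real assume q: "q \<in> CS" and e: "0 < e"
  obtain f where f: "f \<in> W" "0 < f x" using weight_pos[OF assms(3)] by blast
  have "0 < f x * e" using f e by simp
  from fun_space.limitin_seminormD[OF assms(1) N_CS[OF f(1) assms(2) q] this]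
  show "\<forall>\<^sub>F z in G. D w (h z) x \<in> topspace T \<and> q (D w (h z) x - D w l x) < e"
  proof eventually_elim
    case (elim z)
    then have hz: "h z \<in> S" by simp
    have "f x * q (D w (h z) x - D w l x) \<le> N f w q (h z - l)"
      using weighted_norm_upper[OF S_diff[OF hz l] f(1) q assms(2,3)] D_diff[OF hz l assms(2)] by simp
    also have "\<dots> < f x * e" using elim by blast
    finally show ?case using f D_topspace[OF S_Ck[OF hz] assms(2)] by simp
  qed
qed

end

section \<open>A mean value estimate for seminorms\<close>

context seminorm_space
begin

text \<open>
  The estimate with \<open>M\<close> enlarged to \<open>M + e\<close> is additive over adjacent intervals and, by
  differentiability, holds on all short intervals around a point; bisection extends it to \<open>[a, b]\<close>.
\<close>

lemma mean_value_seminorm: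
  fixes h h' :: "real \<Rightarrow> 'e"
  assumes q: "q \<in> CS" and ab: "a \<le> b" and h: "\<And>s. h s \<in> topspace T" and d: "d \<in> topspace T"
    and der: "\<And>s. s \<in> {a..b} \<Longrightarrow>
      limitin T (\<lambda>t. sc (of_real (1 / t)) (h (s + t) - h s)) (h' s) (at 0)"
    and M: "\<And>s. s \<in> {a..b} \<Longrightarrow> q (h' s - d) \<le> M"
  shows "q (h b - h a - sc (of_real (b - a)) d) \<le> M * (b - a)"
proof -
  (* subtracting a linear map reduces to a derivative bounded by M *)
  define r where "r s = h s - sc (of_real s) d" for s
  have r: "r s \<in> topspace T" for s
    unfolding r_def using h d subspace_diff[OF subspace_S] subspace_scale[OF subspace_S] by blast
  have est: "q (r b - r a) \<le> (M + e) * (b - a)" if e: "e > 0" for e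
    using ab
  proof (induction rule: Bolzano)
    case (trans a b c)
    have "q (r c - r a) \<le> q (r c - r b) + q (r b - r a)" by (rule CS_diff_triangle[OF q r r r])
    then show ?case using trans by (simp add: algebra_simps)
  next
    case (local s)
    then have s: "s \<in> {a..b}" by simp
    have hs: "h' s \<in> topspace T" using der[OF s] by (simp add: limitin_def)
    have "\<forall>\<^sub>F t in at 0. q (sc (of_real (1 / t)) (h (s + t) - h s) - h' s) < e"
      using limitin_seminormD[OF der[OF s] q e] by (rule eventually_mono) simp
    then obtain \<delta> where dl: "\<delta> > 0"
      "\<And>t. t \<noteq> 0 \<Longrightarrow> \<bar>t\<bar> < \<delta> \<Longrightarrow> q (sc (of_real (1 / t)) (h (s + t) - h s) - h' s) < e"
      unfolding eventually_at by (auto simp: dist_real_def)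
    have M0: "0 \<le> M"
      using M[OF s] CS_nonneg[OF q subspace_diff[OF subspace_S hs d]] by linarith
    have step: "q (r (s + t) - r s) \<le> (M + e) * \<bar>t\<bar>" if t: "\<bar>t\<bar> < \<delta>" for t
    proof (cases "t = 0")
      case True
      then show ?thesis using CS_0[OF q] by simp
    next
      case False
      let ?p = "sc (of_real (1 / t)) (h (s + t) - h s) - h' s"
      have p: "?p \<in> topspace T" "h' s - d \<in> topspace T"
        using h hs d subspace_diff[OF subspace_S] subspace_scale[OF subspace_S] by blast+
      have "r (s + t) - r s = sc (of_real t) (?p + (h' s - d))"
        using False unfolding r_def
        by (simp add: scale_right_diff_distrib scale_left_distrib)
      then have "q (r (s + t) - r s) = \<bar>t\<bar> * q (?p + (h' s - d))"
        using CS_scale[OF q subspace_add[OF subspace_S p]] by simp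
      also have "\<dots> \<le> \<bar>t\<bar> * (e + M)"
        using CS_triangle[OF q p] dl(2)[OF False t] M[OF s] by (intro mult_left_mono) auto
      finally show ?thesis by (simp add: algebra_simps)
    qed
    have "q (r b' - r a') \<le> (M + e) * (b' - a')" if "a' \<le> s" "s \<le> b'" "b' - a' < \<delta>" for a' b'
    proof -
      have "q (r b' - r a') \<le> q (r b' - r s) + q (r s - r a')" by (rule CS_diff_triangle[OF q r r r])
      also have "\<dots> = q (r (s + (b' - s)) - r s) + q (r (s + (a' - s)) - r s)"
        using CS_diff_commute[OF q r[of s] r[of a']] by simp
      also have "\<dots> \<le> (M + e) * \<bar>b' - s\<bar> + (M + e) * \<bar>a' - s\<bar>"
        using that by (intro add_mono step) auto
      also have "\<dots> = (M + e) * (b' - a')" using that by (simp add: algebra_simps)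
      finally show ?thesis .
    qed
    then show ?case using dl(1) by blast
  qed
  have "q (r b - r a) \<le> M * (b - a)"
  proof (cases "a = b")
    case True
    then show ?thesis using CS_0[OF q] by simp
  next
    case False
    then have ba: "b - a > 0" using ab by simp
    show ?thesis
    proof (rule field_le_epsilon)
      fix e :: real assume "e > 0"
      then have "q (r b - r a) \<le> (M + e / (b - a)) * (b - a)" using ba by (intro est) simp
      then show "q (r b - r a) \<le> M * (b - a) + e" using ba by (simp add: distrib_right)
    qed
  qed
  moreover have "r b - r a = h b - h a - sc (of_real (b - a)) d"
    unfolding r_def by (simp add: scale_left_diff_distrib)
  ultimately show ?thesis by simp
qed

text \<open>The mean value estimate on \<open>[0, t]\<close> or \<open>[t, 0]\<close>, divided by \<open>\<bar>t\<bar>\<close>.\<close>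

lemma difference_quotient_bound:
  fixes h h' :: "real \<Rightarrow> 'e"
  assumes q: "q \<in> CS" and t: "t \<noteq> 0" and h: "\<And>s. h s \<in> topspace T" and d: "d \<in> topspace T"
    and der: "\<And>s. \<bar>s\<bar> \<le> \<bar>t\<bar> \<Longrightarrow>
      limitin T (\<lambda>t. sc (of_real (1 / t)) (h (s + t) - h s)) (h' s) (at 0)"
    and M: "\<And>s. \<bar>s\<bar> \<le> \<bar>t\<bar> \<Longrightarrow> q (h' s - d) \<le> M"
  shows "q (sc (of_real (1 / t)) (h t - h 0) - d) \<le> M"
proof -
  let ?v = "h t - h 0 - sc (of_real t) d"
  have v: "?v \<in> topspace T"
    using h d subspace_diff[OF subspace_S] subspace_scale[OF subspace_S] by blast
  have "q ?v \<le> M * \<bar>t\<bar>"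
  proof (cases "0 \<le> t")
    case True
    then have "q (h t - h 0 - sc (of_real (t - 0)) d) \<le> M * (t - 0)"
      using der M by (intro mean_value_seminorm[OF q True h d, where h' = h']) auto
    then show ?thesis using True by simp
  next
    case False
    have "q (h 0 - h t - sc (of_real (0 - t)) d) \<le> M * (0 - t)"
      using False der M by (intro mean_value_seminorm[OF q _ h d, where h' = h']) auto
    moreover have "h 0 - h t - sc (of_real (0 - t)) d = - ?v" by simp
    ultimately have "q (- ?v) \<le> M * (0 - t)" by (simp only:)
    then show ?thesis
      unfolding seminorm_minus[OF CS_seminorm[OF q] v] using False by simp
  qed
  moreover have "sc (of_real (1 / t)) (h t - h 0) - d = sc (of_real (1 / t)) ?v"
    using t by (simp add: scale_right_diff_distrib)
  moreover have "q (sc (of_real (1 / t)) ?v) = q ?v / \<bar>t\<bar>"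
    unfolding CS_scale[OF q v] by (simp add: norm_divide)
  moreover have "0 < \<bar>t\<bar>" using t by simp
  ultimately show ?thesis by (simp only: pos_divide_le_eq)
qed

end

section \<open>Families of mixed partial derivatives\<close>

locale two_weighted_spaces =
  X: weighted_space sc T k U W1 + Y: weighted_space sc T l V W2
  for sc :: "'k::real_normed_field \<Rightarrow> 'e::ab_group_add \<Rightarrow> 'e" and T :: "'e topology"
    and k :: enat and U :: "(real^'n::{finite,linorder}) set" and W1
    and l :: enat and V :: "(real^'m::{finite,linorder}) set" and W2
begin

sublocale XY: weighted_space "fun_scale sc" Y.F k U W1
  by (intro weighted_space.intro weighted_space_axioms.intro
      Y.fun_space.seminorm_space_axioms X.open_U X.weights X.continuous_weight)

sublocale YX: weighted_space "fun_scale sc" X.F l V W2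
  by (intro weighted_space.intro weighted_space_axioms.intro
      X.fun_space.seminorm_space_axioms Y.open_U Y.weights Y.continuous_weight)

end

text \<open>
  \<open>A u w\<close> stands for the partial derivative along \<open>u\<close> in the first and along \<open>w\<close> in the second
  variable of one function on \<open>U \<times> V\<close>.  The conditions are invariant under exchanging
  the variables.  They mediate between the two nested function spaces: every element of one
  space yields such a family, and under the o-condition such a family yields an element of the other.
\<close>

locale mixed_family = two_weighted_spaces sc T k U W1 l V W2
  for sc :: "'k::real_normed_field \<Rightarrow> 'e::ab_group_add \<Rightarrow> 'e" and T :: "'e topology"
    and k :: enat and U :: "(real^'n::{finite,linorder}) set" and W1
    and l :: enat and V :: "(real^'m::{finite,linorder}) set" and W2 +
  fixes A :: "'n list \<Rightarrow> 'm list \<Rightarrow> real^'n::{finite,linorder} \<Rightarrow> real^'m::{finite,linorder} \<Rightarrow> 'e"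
  assumes outside: "admissible k u \<Longrightarrow> admissible l w \<Longrightarrow> x \<notin> U \<or> y \<notin> V \<Longrightarrow> A u w x y = 0"
    and topspace: "admissible k u \<Longrightarrow> admissible l w \<Longrightarrow> A u w x y \<in> topspace T"
    and derivative1: "admissible k (j # u) \<Longrightarrow> admissible l w \<Longrightarrow> x \<in> U \<Longrightarrow> y \<in> V \<Longrightarrow>
      has_partial_derivative sc T j (\<lambda>x. A u w x y) x (A (j # u) w x y)"
    and derivative2: "admissible k u \<Longrightarrow> admissible l (i # w) \<Longrightarrow> x \<in> U \<Longrightarrow> y \<in> V \<Longrightarrow>
      has_partial_derivative sc T i (\<lambda>y. A u w x y) y (A u (i # w) x y)"
    and jointly_continuous: "admissible k u \<Longrightarrow> admissible l w \<Longrightarrow> x0 \<in> U \<Longrightarrow> y0 \<in> V \<Longrightarrow>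
      q \<in> continuous_seminorms sc T \<Longrightarrow> 0 < e \<Longrightarrow> \<exists>B C. open B \<and> x0 \<in> B \<and> open C \<and> y0 \<in> C \<and>
        (\<forall>x\<in>B. \<forall>y\<in>C. q (A u w x y - A u w x0 y0) < e)"
    and bounded: "admissible k u \<Longrightarrow> admissible l w \<Longrightarrow> f \<in> W1 \<Longrightarrow> g \<in> W2 \<Longrightarrow>
      q \<in> continuous_seminorms sc T \<Longrightarrow> \<exists>C. \<forall>x\<in>U. \<forall>y\<in>V. f x * g y * q (A u w x y) \<le> C"
begin

text \<open>For fixed \<open>y\<close>, the derivative along \<open>w\<close> in the second variable as a function of the first; these
  functions are going to be the iterated partial derivatives of \<open>slice []\<close>, a map into a function
  space.\<close>

definition slice :: "'m list \<Rightarrow> real^'m::{finite,linorder} \<Rightarrow> real^'n::{finite,linorder} \<Rightarrow> 'e" where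
  "slice w y = (\<lambda>x. A [] w x y)"

lemma iterated_partial_slice:
  assumes "admissible k u" "admissible l w"
  shows "iterated_partial_exists sc T U u (slice w y) \<and> X.D u (slice w y) = (\<lambda>x. A u w x y)"
proof (cases "y \<in> V")
  case True
  have "iterated_partial_exists sc T U u (\<lambda>x. A [] w x y) \<and> X.D u (\<lambda>x. A [] w x y) = (\<lambda>x. A u w x y)"
  proof (rule X.iterated_partial_family[where H = "\<lambda>u x. A u w x y", OF assms(1)])
    show "A u w x y = 0" if "admissible k u" "x \<notin> U" for u x
      using outside[OF that(1) assms(2)] that(2) by simp
    show "has_partial_derivative sc T j (\<lambda>x. A u w x y) x (A (j # u) w x y)"
      if "admissible k (j # u)" "x \<in> U" for j u x
      using derivative1[OF that(1) assms(2) that(2) True] .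
  qed
  then show ?thesis by (simp add: slice_def)
next
  case False
  then have *: "A u w x y = 0" if "admissible k u" for u x using that assms(2) outside by blast
  have "iterated_partial_exists sc T U u 0 \<and> X.D u 0 = 0"
    using X.iterated_partial_scale[OF X.S_Ck[OF X.zero_S] assms(1), of 0]
    by (simp add: fun_scale_def zero_fun_def)
  moreover have "slice w y = 0" "(\<lambda>x. A u w x y) = 0"
    using *[of "[]"] *[OF assms(1)] by (auto simp: slice_def)
  ultimately show ?thesis by simp
qed

text \<open>Near \<open>y0\<close> the weight in the second variable can be dropped from the bounds, since some weight
  exceeds half of its positive value at \<open>y0\<close> there.\<close>

lemma locally_bounded:
  assumes "admissible k u" "admissible l w" "f \<in> W1" "q \<in> continuous_seminorms sc T" "y0 \<in> V"
  obtains C B where "0 < C" "open B" "y0 \<in> B" "B \<subseteq> V" "\<And>x y. x \<in> U \<Longrightarrow> y \<in> B \<Longrightarrow> f x * q (A u w x y) \<le> C"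
proof -
  obtain g where g: "g \<in> W2" "0 < g y0" using Y.weight_pos[OF assms(5)] by blast
  obtain C where C: "\<forall>x\<in>U. \<forall>y\<in>V. f x * g y * q (A u w x y) \<le> C"
    using bounded[OF assms(1-3) g(1) assms(4)] by blast
  define B where "B = {y \<in> V. g y0 / 2 < g y}"
  have "open (V \<inter> g -` {g y0 / 2<..})"
    using Y.continuous_weight[OF g(1)] Y.open_U by (intro continuous_open_preimage) auto
  moreover have "V \<inter> g -` {g y0 / 2<..} = B" by (auto simp: B_def)
  ultimately have "open B" by simp
  moreover have "y0 \<in> B" "B \<subseteq> V" using g assms(5) by (auto simp: B_def)
  moreover have "f x * q (A u w x y) \<le> 2 * (\<bar>C\<bar> + 1) / g y0" if "x \<in> U" "y \<in> B" for x y
  proof -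
    have y: "y \<in> V" "g y0 / 2 < g y" using that by (auto simp: B_def)
    have fq: "0 \<le> f x * q (A u w x y)"
      using X.weight_nonneg[OF assms(3) that(1)] X.CS_nonneg[OF assms(4) topspace[OF assms(1,2)]] by simp
    have "g y0 / 2 * (f x * q (A u w x y)) \<le> g y * (f x * q (A u w x y))"
      using y fq by (intro mult_right_mono) auto
    also have "\<dots> \<le> \<bar>C\<bar> + 1" using bspec[OF bspec[OF C that(1)] y(1)] by (simp add: mult.commute mult.left_commute)
    finally show ?thesis using g by (simp add: field_simps)
  qed
  moreover have "0 < 2 * (\<bar>C\<bar> + 1) / g y0" using g by simp
  ultimately show ?thesis using that by blast
qed

lemma slice_space: 
  assumes w: "admissible l w"
  shows "slice w y \<in> X.S"
proof (cases "y \<in> V")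
  case True
  show ?thesis
    unfolding weighted_Ck_iff Ck_iff
  proof (intro conjI ballI allI impI)
    fix x assume "x \<notin> U"
    then show "slice w y x = 0" using outside w by (simp add: slice_def)
  next
    fix u :: "'n list" assume u: "admissible k u"
    show "iterated_partial_exists sc T U u (slice w y)" using iterated_partial_slice u w by blast
    have "limitin T (\<lambda>x. A u w x y) (A u w x0 y) (at x0)" if x0: "x0 \<in> U" for x0
      unfolding X.limitin_seminorm_iff
    proof (intro conjI ballI allI impI)
      show "A u w x0 y \<in> topspace T" using topspace u w by blast
      fix q and e :: real assume "q \<in> X.CS" "0 < e"
      from jointly_continuous[OF u w x0 True this] obtain B C where "open B" "x0 \<in> B" "open C" "y \<in> C"
        "\<forall>x\<in>B. \<forall>y'\<in>C. q (A u w x y' - A u w x0 y) < e"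
        by (elim exE conjE)
      then show "\<forall>\<^sub>F x in at x0. A u w x y \<in> topspace T \<and> q (A u w x y - A u w x0 y) < e"
        unfolding eventually_at_topological using topspace[OF u w] by blast
    qed
    then show "continuous_map (top_of_set U) T (X.D u (slice w y))"
      unfolding iterated_partial_slice[OF u w, THEN conjunct2] continuous_map_open_iff_limitin[OF X.open_U]
      by blast
  next
    fix f q and u :: "'n list" assume *: "f \<in> W1" "q \<in> X.CS" "admissible k u"
    obtain C B where "y \<in> B" "\<And>x y. x \<in> U \<Longrightarrow> y \<in> B \<Longrightarrow> f x * q (A u w x y) \<le> C"
      using locally_bounded[OF *(3) w *(1,2) True] by metis
    then show "\<exists>C. \<forall>x\<in>U. f x * q (X.D u (slice w y) x) \<le> C"
      using iterated_partial_slice[OF *(3) w, of y] by auto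
  qed
next
  case False
  then have "slice w y = 0" using outside w by (auto simp: slice_def)
  then show ?thesis using X.zero_S by simp
qed

text \<open>
  Off a compact set the weight is dominated by a small multiple of a larger weight, for which the
  family is bounded; on the compact set joint continuity is uniform.
\<close>

lemma slice_uniformly_continuous:
  assumes o: "o_condition U W1" and u: "admissible k u" and w: "admissible l w" and f: "f \<in> W1"
    and q: "q \<in> continuous_seminorms sc T" and y0: "y0 \<in> V" and e: "0 < e"
  shows "\<exists>B. open B \<and> y0 \<in> B \<and> B \<subseteq> V \<and>
    (\<forall>y\<in>B. \<forall>x\<in>U. f x * q (A u w x y - A u w x y0) \<le> e)"
proof -
  note A = topspace[OF u w]
  obtain g where g: "g \<in> W1" "little_o_on U f g" using o f unfolding o_condition_def by blast
  obtain C B where C: "0 < C" and B: "open B" "y0 \<in> B" "B \<subseteq> V"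
    and bnd: "\<And>x y. x \<in> U \<Longrightarrow> y \<in> B \<Longrightarrow> g x * q (A u w x y) \<le> C"
    using locally_bounded[OF u w g(1) q y0] by metis
  have "0 < e / (2 * C)" using C e by simp
  then obtain K where K: "compact K" "K \<subseteq> U" "\<And>x. x \<in> U - K \<Longrightarrow> f x \<le> e / (2 * C) * g x"
    using g(2) unfolding little_o_on_def by meson
  have off: "f x * q (A u w x y - A u w x y0) \<le> e" if x: "x \<in> U - K" and y: "y \<in> B" for x y
  proof -
    let ?s = "q (A u w x y) + q (A u w x y0)"
    have s: "0 \<le> ?s" using X.CS_nonneg[OF q A] by simp
    have "q (A u w x y - A u w x y0) \<le> ?s"
      using X.CS_diff_triangle[OF q A X.subspace_0[OF X.subspace_S] A, of x y x y0]
        X.seminorm_minus[OF X.CS_seminorm[OF q] A, of x y0] by simp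
    (* of the two terms in ?s each contributes at most e / 2, which fixes the factor e / (2 * C) *)
    then have "f x * q (A u w x y - A u w x y0) \<le> f x * ?s"
      using X.weight_nonneg[OF f] x by (intro mult_left_mono) auto
    also have "\<dots> \<le> e / (2 * C) * g x * ?s" using K(3)[OF x] s by (intro mult_right_mono)
    also have "\<dots> = e / (2 * C) * (g x * q (A u w x y) + g x * q (A u w x y0))"
      by (simp only: distrib_left mult.assoc)
    also have "\<dots> \<le> e / (2 * C) * (C + C)"
      using bnd[of x y] bnd[of x y0] x y B(2) C e by (intro mult_left_mono) auto
    also have "\<dots> = e" using C by simp
    finally show ?thesis .
  qed
  have "compact (f ` K)"
    using X.continuous_weight[OF f] K by (intro compact_continuous_image) (auto intro: continuous_on_subset)
  then obtain M where M: "0 < M" "\<And>x. x \<in> K \<Longrightarrow> f x \<le> M"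
    using compact_imp_bounded[THEN bounded_pos[THEN iffD1]] by (force simp: abs_le_iff)
  (* x is compared with the centre x0 of its neighbourhood twice, at y and at y0 *)
  define d where "d = e / (2 * M)"
  have d: "0 < d" using e M by (simp add: d_def)
  have "\<forall>x0\<in>K. \<exists>B' C'. open B' \<and> x0 \<in> B' \<and> open C' \<and> y0 \<in> C' \<and>
        (\<forall>x\<in>B'. \<forall>y\<in>C'. q (A u w x y - A u w x0 y0) < d)"
    using jointly_continuous[OF u w _ y0 q d] K(2) by blast
  then obtain B' C' where BC: "\<And>x0. x0 \<in> K \<Longrightarrow> open (B' x0) \<and> x0 \<in> B' x0 \<and> open (C' x0) \<and> y0 \<in> C' x0 \<and>
        (\<forall>x\<in>B' x0. \<forall>y\<in>C' x0. q (A u w x y - A u w x0 y0) < d)"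
    by metis
  have "K \<subseteq> (\<Union>x0\<in>K. B' x0)" using BC by blast
  then obtain K' where K': "K' \<subseteq> K" "finite K'" "K \<subseteq> (\<Union>x0\<in>K'. B' x0)"
    using compactE_image[OF K(1), of K B'] BC by metis
  define Z where "Z = B \<inter> (\<Inter>x0\<in>K'. C' x0)"
  have Z: "open Z" "y0 \<in> Z" "Z \<subseteq> V"
    unfolding Z_def using B BC K' by (auto intro!: open_Int open_INT)
  have "f x * q (A u w x y - A u w x y0) \<le> e" if x: "x \<in> U" and y: "y \<in> Z" for x y
  proof (cases "x \<in> K")
    case True
    then obtain x0 where x0: "x0 \<in> K'" "x \<in> B' x0" using K' by blast
    then have "q (A u w x y - A u w x0 y0) < d" "q (A u w x y0 - A u w x0 y0) < d"
      using BC[of x0] K'(1) y unfolding Z_def by blast+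
    then have "q (A u w x y - A u w x y0) \<le> 2 * d"
      using X.CS_diff_triangle[OF q A[of x y] A[of x0 y0] A[of x y0]]
        X.CS_diff_commute[OF q A A, of x0 y0 x y0] by linarith
    then have "f x * q (A u w x y - A u w x y0) \<le> M * (2 * d)"
      using M True X.weight_nonneg[OF f x] X.CS_nonneg[OF q X.subspace_diff[OF X.subspace_S A A]]
      by (intro mult_mono) auto
    also have "\<dots> = e" using M by (simp add: d_def)
    finally show ?thesis .
  next
    case False
    then show ?thesis using off x y by (simp add: Z_def)
  qed
  then show ?thesis using Z by blast
qed

lemma limitin_slice:
  assumes "l0 \<in> X.S" "\<And>z. h z \<in> X.S"
    and "\<And>f u q e. f \<in> W1 \<Longrightarrow> admissible k u \<Longrightarrow> q \<in> X.CS \<Longrightarrow> 0 < e \<Longrightarrow>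
      \<forall>\<^sub>F z in F. \<forall>x\<in>U. f x * q (X.D u (h z) x - X.D u l0 x) \<le> e"
  shows "limitin X.F h l0 F"
  unfolding X.F_eq
proof (rule X.fun_space.limitin_generators)
  fix p and e :: real assume "p \<in> weighted_norms sc T k W1 U" "0 < e"
  then obtain f u q where p: "p = X.N f u q" "f \<in> W1" "admissible k u" "q \<in> X.CS"
    and e: "0 < e / 2"
    unfolding weighted_norms_def by auto
  show "\<forall>\<^sub>F z in F. p (h z - l0) < e"
    using assms(3)[OF p(2-4) e]
  proof eventually_elim
    case (elim z)
    have "p (h z - l0) \<le> e / 2"
      unfolding p(1) using elim e X.D_diff[OF assms(2,1) p(3)] by (intro weighted_norm_leI) auto
    then show ?case using e by linarith
  qed
qed (use assms in auto)

lemma slice_continuous: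
  assumes o: "o_condition U W1" and w: "admissible l w"
  shows "continuous_map (top_of_set V) X.F (slice w)"
  unfolding continuous_map_open_iff_limitin[OF Y.open_U]
proof (intro ballI limitin_slice slice_space w)
  fix y0 f q and u :: "'n list" and e :: real
  assume "y0 \<in> V" and f: "f \<in> W1" and u: "admissible k u" and q: "q \<in> X.CS" and "0 < e"
  then obtain B where "open B" "y0 \<in> B" "\<forall>y\<in>B. \<forall>x\<in>U. f x * q (A u w x y - A u w x y0) \<le> e"
    using slice_uniformly_continuous[OF o u w f q] by blast
  then show "\<forall>\<^sub>F y in at y0. \<forall>x\<in>U. f x * q (X.D u (slice w y) x - X.D u (slice w y0) x) \<le> e"
    unfolding eventually_at_topological using iterated_partial_slice[OF u w] by auto
qed

text \<open>By the mean value estimate, the error of a difference quotient is controlled by the oscillation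
  of the derivative, uniformly in the first variable.\<close>

lemma slice_partial_derivative:
  assumes o: "o_condition U W1" and iw: "admissible l (i # w)" and y0: "y0 \<in> V"
  shows "has_partial_derivative (fun_scale sc) X.F i (slice w) y0 (slice (i # w) y0)"
  unfolding has_partial_derivative_def
proof (rule limitin_slice)
  have w: "admissible l w" using iw by (rule admissible_ConsD)
  show "slice (i # w) y0 \<in> X.S" using iw by (rule slice_space)
  show "fun_scale sc (of_real (1 / t)) (slice w (y0 + t *\<^sub>R axis i 1) - slice w y0) \<in> X.S" for t
    by (intro X.S_scale X.S_diff slice_space w)
  fix f q and u :: "'n list" and e :: real
  assume f: "f \<in> W1" and u: "admissible k u" and q: "q \<in> X.CS" and e: "0 < e"
  obtain B where B: "open B" "y0 \<in> B" "B \<subseteq> V"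
      "\<forall>y\<in>B. \<forall>x\<in>U. f x * q (A u (i # w) x y - A u (i # w) x y0) \<le> e"
    using slice_uniformly_continuous[OF o u iw f q y0 e] by blast
  obtain \<delta> where dl: "\<delta> > 0" "\<And>y. dist y y0 < \<delta> \<Longrightarrow> y \<in> B"
    using B(1,2) unfolding open_dist by blast
  have line: "y0 + s *\<^sub>R axis i 1 \<in> B" if "\<bar>s\<bar> < \<delta>" for s
    using that by (intro dl(2)) (simp add: dist_norm)
  have "\<forall>x\<in>U. f x * q (X.D u (fun_scale sc (of_real (1 / t)) (slice w (y0 + t *\<^sub>R axis i 1) - slice w y0)) x -
      X.D u (slice (i # w) y0) x) \<le> e" if t: "t \<noteq> 0" "\<bar>t\<bar> < \<delta>" for t
  proof
    fix x assume x: "x \<in> U"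
    have q': "(\<lambda>v. f x * q v) \<in> X.CS" using X.CS_mult X.weight_nonneg[OF f x] q by blast
    have "f x * q (sc (of_real (1 / t)) (A u w x (y0 + t *\<^sub>R axis i 1) - A u w x (y0 + 0 *\<^sub>R axis i 1)) -
        A u (i # w) x y0) \<le> e"
    proof (rule X.difference_quotient_bound[OF q' t(1), where h = "\<lambda>s. A u w x (y0 + s *\<^sub>R axis i 1)"
          and h' = "\<lambda>s. A u (i # w) x (y0 + s *\<^sub>R axis i 1)"])
      show "A u w x (y0 + s *\<^sub>R axis i 1) \<in> topspace T" for s using topspace u w by blast
      show "A u (i # w) x y0 \<in> topspace T" using topspace u iw by blast
      fix s :: real assume "\<bar>s\<bar> \<le> \<bar>t\<bar>"
      then have s: "y0 + s *\<^sub>R axis i 1 \<in> B" using t line by simp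
      then show "f x * q (A u (i # w) x (y0 + s *\<^sub>R axis i 1) - A u (i # w) x y0) \<le> e" using B(4) x by blast
      show "limitin T (\<lambda>t. sc (of_real (1 / t)) (A u w x (y0 + (s + t) *\<^sub>R axis i 1) -
          A u w x (y0 + s *\<^sub>R axis i 1))) (A u (i # w) x (y0 + s *\<^sub>R axis i 1)) (at 0)"
        using derivative2[OF u iw x subsetD[OF B(3) s]]
        by (simp add: has_partial_derivative_def scaleR_add_left add.assoc)
    qed
    moreover have "X.D u (fun_scale sc (of_real (1 / t)) (slice w (y0 + t *\<^sub>R axis i 1) - slice w y0)) x =
        sc (of_real (1 / t)) (A u w x (y0 + t *\<^sub>R axis i 1) - A u w x y0)"
      using X.D_scale[OF X.S_diff[OF slice_space[OF w] slice_space[OF w]] u]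
        X.D_diff[OF slice_space[OF w] slice_space[OF w] u] iterated_partial_slice[OF u w] by simp
    ultimately show "f x * q (X.D u (fun_scale sc (of_real (1 / t)) (slice w (y0 + t *\<^sub>R axis i 1) - slice w y0)) x -
        X.D u (slice (i # w) y0) x) \<le> e"
      using iterated_partial_slice[OF u iw] by simp
  qed
  then show "\<forall>\<^sub>F t in at 0. \<forall>x\<in>U. f x * q (X.D u (fun_scale sc (of_real (1 / t))
      (slice w (y0 + t *\<^sub>R axis i 1) - slice w y0)) x - X.D u (slice (i # w) y0) x) \<le> e"
    unfolding eventually_at using dl(1) by (intro exI[of _ \<delta>]) (auto simp: dist_real_def)
qed

lemma iterated_partial_slices:
  assumes "o_condition U W1" "admissible l w"
  shows "iterated_partial_exists (fun_scale sc) X.F V w (slice []) \<and> YX.D w (slice []) = slice w"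
  using assms(2)
proof (rule X.fun_space.iterated_partial_family)
  fix w :: "'m list" and y assume "admissible l w" "y \<notin> V"
  then show "slice w y = 0" using outside by (auto simp: slice_def)
qed (rule slice_partial_derivative[OF assms(1)])

text \<open>Since \<open>p\<close> is bounded by finitely many weighted norms, the two-variable bounds of the family
  suffice for an arbitrary continuous seminorm of the inner space.\<close>

lemma weighted_norm_slice_bounded:
  assumes "admissible l w" "g \<in> W2" "p \<in> X.fun_space.CS"
  shows "\<exists>C. \<forall>y\<in>V. g y * p (slice w y) \<le> C"
proof -
  obtain Q C where Q: "finite Q" "Q \<subseteq> weighted_norms sc T k W1 U" "0 \<le> C"
      "\<And>\<eta>. \<eta> \<in> X.S \<Longrightarrow> p \<eta> \<le> C * (\<Sum>n\<in>Q. n \<eta>)"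
    using X.fun_space.continuous_seminorm_dominated assms(3) unfolding X.F_eq by metis
  have "\<forall>n\<in>Q. \<exists>C. \<forall>y\<in>V. g y * n (slice w y) \<le> C"
  proof
    fix n assume "n \<in> Q"
    then obtain f u q where n: "n = X.N f u q" "f \<in> W1" "admissible k u" "q \<in> X.CS"
      using Q(2) unfolding weighted_norms_def by blast
    then obtain C where C: "\<forall>x\<in>U. \<forall>y\<in>V. f x * g y * q (A u w x y) \<le> C"
      using bounded[OF n(3) assms(1) n(2) assms(2) n(4)] by blast
    have "g y * n (slice w y) \<le> \<bar>C\<bar>" if y: "y \<in> V" for y
    proof (cases "g y = 0")
      case False
      then have g: "0 < g y" using Y.weight_nonneg[OF assms(2) y] by simp
      have "n (slice w y) \<le> \<bar>C\<bar> / g y"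
        unfolding n(1)
      proof (rule weighted_norm_leI)
        fix x assume "x \<in> U"
        then have "f x * g y * q (A u w x y) \<le> \<bar>C\<bar>" using C y by fastforce
        then show "f x * q (X.D u (slice w y) x) \<le> \<bar>C\<bar> / g y"
          using g iterated_partial_slice[OF n(3) assms(1)] by (simp add: field_simps)
      qed (use g in simp)
      then show ?thesis using g by (simp add: field_simps)
    qed simp
    then show "\<exists>C. \<forall>y\<in>V. g y * n (slice w y) \<le> C" by blast
  qed
  then obtain c where c: "\<And>n y. n \<in> Q \<Longrightarrow> y \<in> V \<Longrightarrow> g y * n (slice w y) \<le> c n" by metis
  have "g y * p (slice w y) \<le> C * (\<Sum>n\<in>Q. c n)" if y: "y \<in> V" for y
  proof -
    have "g y * p (slice w y) \<le> g y * (C * (\<Sum>n\<in>Q. n (slice w y)))"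
      using Q(4)[OF slice_space[OF assms(1)]] Y.weight_nonneg[OF assms(2) y] by (intro mult_left_mono)
    also have "\<dots> = C * (\<Sum>n\<in>Q. g y * n (slice w y))" by (simp add: sum_distrib_left mult.left_commute)
    also have "\<dots> \<le> C * (\<Sum>n\<in>Q. c n)" using Q(3) c y by (intro mult_left_mono sum_mono) auto
    finally show ?thesis .
  qed
  then show ?thesis by blast
qed

lemma slices_space:
  assumes "o_condition U W1"
  shows "slice [] \<in> YX.S"
  unfolding weighted_Ck_iff Ck_iff
proof (intro conjI ballI allI impI)
  fix y assume "y \<notin> V"
  then show "slice [] y = 0" using outside by (auto simp: slice_def)
next
  fix w :: "'m list" assume "admissible l w"
  then show "iterated_partial_exists (fun_scale sc) X.F V w (slice [])"
    "continuous_map (top_of_set V) X.F (YX.D w (slice []))"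
    using iterated_partial_slices[OF assms] slice_continuous[OF assms] by auto
next
  fix g p and w :: "'m list" assume "g \<in> W2" "p \<in> X.fun_space.CS" "admissible l w"
  then show "\<exists>C. \<forall>y\<in>V. g y * p (YX.D w (slice []) y) \<le> C"
    using iterated_partial_slices[OF assms] weighted_norm_slice_bounded by auto
qed

end

section \<open>Exchanging the variables\<close>

context two_weighted_spaces
begin

lemma XY_derivative_space: "\<gamma> \<in> XY.S \<Longrightarrow> admissible k u \<Longrightarrow> XY.D u \<gamma> x \<in> Y.S"
  using XY.D_topspace[OF XY.S_Ck, of \<gamma> u x] by simp

text \<open>
  Continuity of \<open>x \<mapsto> XY.D u \<gamma> x\<close> in the inner weighted space is uniform on neighbourhoods where a weight is
  bounded below, so it combines with continuity in \<open>y\<close> at the single point \<open>x0\<close>.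
\<close>

lemma nested_jointly_continuous:
  assumes g: "\<gamma> \<in> XY.S" and u: "admissible k u" and w: "admissible l w" and x0: "x0 \<in> U"
    and y0: "y0 \<in> V" and q: "q \<in> X.CS" and e: "0 < e"
  shows "\<exists>B C. open B \<and> x0 \<in> B \<and> open C \<and> y0 \<in> C \<and>
    (\<forall>x\<in>B. \<forall>y\<in>C. q (Y.D w (XY.D u \<gamma> x) y - Y.D w (XY.D u \<gamma> x0) y0) < e)"
proof -
  note S = XY_derivative_space[OF g u]
  note T = Y.D_topspace[OF Y.S_Ck[OF S] w]
  obtain f where f: "f \<in> W2" "0 < f y0" using Y.weight_pos[OF y0] by blast
  obtain C where C: "open C" "y0 \<in> C" "C \<subseteq> V"
    "\<And>y. y \<in> C \<Longrightarrow> q (Y.D w (XY.D u \<gamma> x0) y - Y.D w (XY.D u \<gamma> x0) y0) < e / 2"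
    using X.continuous_map_nbhd[OF Y.open_U continuous_map_iterated_partial[OF Y.S_Ck[OF S] w] y0 q
        half_gt_zero[OF e]] by metis
  (* the second e / 2 of the error, scaled by a lower bound of the weight near y0 *)
  have "0 < f y0 / 2 * (e / 2)" using f e by simp
  then obtain B where B: "open B" "x0 \<in> B" "B \<subseteq> U"
    "\<And>x. x \<in> B \<Longrightarrow> Y.N f w q (XY.D u \<gamma> x - XY.D u \<gamma> x0) < f y0 / 2 * (e / 2)"
    using Y.fun_space.continuous_map_nbhd[OF X.open_U continuous_map_iterated_partial[OF XY.S_Ck[OF g] u] x0
        Y.N_CS[OF f(1) w q]] by metis
  have "open (V \<inter> f -` {f y0 / 2<..})"
    using Y.continuous_weight[OF f(1)] Y.open_U by (intro continuous_open_preimage) auto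
  then have "open (C \<inter> (V \<inter> f -` {f y0 / 2<..}))" using C by blast
  moreover have "y0 \<in> C \<inter> (V \<inter> f -` {f y0 / 2<..})" using C y0 f by simp
  moreover have "q (Y.D w (XY.D u \<gamma> x) y - Y.D w (XY.D u \<gamma> x0) y0) < e"
    if x: "x \<in> B" and y: "y \<in> C \<inter> (V \<inter> f -` {f y0 / 2<..})" for x y
  proof -
    let ?d = "Y.D w (XY.D u \<gamma> x) y - Y.D w (XY.D u \<gamma> x0) y"
    have "0 \<le> q ?d" using X.CS_nonneg[OF q X.subspace_diff[OF X.subspace_S T T]] .
    then have "f y0 / 2 * q ?d \<le> f y * q ?d" using y by (intro mult_right_mono) auto
    also have "\<dots> \<le> Y.N f w q (XY.D u \<gamma> x - XY.D u \<gamma> x0)"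
      using weighted_norm_upper[OF Y.S_diff[OF S S] f(1) q w, of y x x0] Y.D_diff[OF S S w] y by simp
    also have "\<dots> < f y0 / 2 * (e / 2)" using B(4)[OF x] .
    finally have "q ?d < e / 2" using f by (simp only: mult_less_cancel_left_pos half_gt_zero)
    then show ?thesis
      using X.CS_diff_triangle[OF q T[of x y] T[of x0 y] T[of x0 y0]] C(4)[of y] y by simp
  qed
  ultimately show ?thesis using B(1,2) by blast
qed

lemma nested_bounded:
  assumes g: "\<gamma> \<in> XY.S" and u: "admissible k u" and w: "admissible l w"
    and f: "f \<in> W1" "f' \<in> W2" and q: "q \<in> X.CS" and xy: "x \<in> U" "y \<in> V"
  shows "f x * f' y * q (Y.D w (XY.D u \<gamma> x) y) \<le> XY.N f u (Y.N f' w q) \<gamma>"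
proof -
  have "f x * (f' y * q (Y.D w (XY.D u \<gamma> x) y)) \<le> f x * Y.N f' w q (XY.D u \<gamma> x)"
    using X.weight_nonneg[OF f(1) xy(1)]
      weighted_norm_upper[OF XY_derivative_space[OF g u] f(2) q w xy(2)] by (intro mult_left_mono)
  also have "\<dots> \<le> XY.N f u (Y.N f' w q) \<gamma>"
    using weighted_norm_upper[OF g f(1) Y.N_CS[OF f(2) w q] u xy(1)] .
  finally show ?thesis by (simp only: mult.assoc)
qed

lemma mixed_family_nested:
  assumes g: "\<gamma> \<in> XY.S"
  shows "mixed_family sc T k U W1 l V W2 (\<lambda>u w x y. Y.D w (XY.D u \<gamma> x) y)"
proof (intro mixed_family.intro two_weighted_spaces_axioms mixed_family_axioms.intro)
  fix u :: "'n list" and w :: "'m list" and x y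
  assume u: "admissible k u" and w: "admissible l w"
  note S = XY_derivative_space[OF g u]
  show "Y.D w (XY.D u \<gamma> x) y \<in> topspace T" using Y.D_topspace[OF Y.S_Ck[OF S] w] .
  assume "x \<notin> U \<or> y \<notin> V"
  then show "Y.D w (XY.D u \<gamma> x) y = 0"
    using iterated_partial_outside[OF XY.S_Ck[OF g], of x u] Y.D_zero[OF w]
      iterated_partial_outside[OF Y.S_Ck[OF S], of y w x] by auto
next
  fix j :: 'n and u :: "'n list" and w :: "'m list" and x y
  assume u: "admissible k (j # u)" and w: "admissible l w" and xy: "x \<in> U" "y \<in> V"
  note S = XY_derivative_space[OF g admissible_ConsD[OF u]]
  have "Y.D w (fun_scale sc c (XY.D u \<gamma> x' - XY.D u \<gamma> x)) y =
      sc c (Y.D w (XY.D u \<gamma> x') y - Y.D w (XY.D u \<gamma> x) y)" for c x'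
    using Y.D_scale[OF Y.S_diff[OF S S] w] Y.D_diff[OF S S w] by simp
  then show "has_partial_derivative sc T j (\<lambda>x. Y.D w (XY.D u \<gamma> x) y) x (Y.D w (XY.D (j # u) \<gamma> x) y)"
    using Y.limitin_evaluation[OF Y.fun_space.has_partial_derivative_Cons[OF
          iterated_partial_exists_Ck[OF XY.S_Ck[OF g] u] xy(1), unfolded has_partial_derivative_def] w xy(2)]
    by (simp add: has_partial_derivative_def del: iterated_partial.simps)
next
  fix i :: 'm and u :: "'n list" and w :: "'m list" and x y
  assume u: "admissible k u" and w: "admissible l (i # w)" and xy: "x \<in> U" "y \<in> V"
  show "has_partial_derivative sc T i (Y.D w (XY.D u \<gamma> x)) y (Y.D (i # w) (XY.D u \<gamma> x) y)"
    using X.has_partial_derivative_Cons[OF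
        iterated_partial_exists_Ck[OF Y.S_Ck[OF XY_derivative_space[OF g u]] w] xy(2)] .
next
  fix u :: "'n list" and w :: "'m list" and f f' q
  assume "admissible k u" "admissible l w" "f \<in> W1" "f' \<in> W2" "q \<in> X.CS"
  then show "\<exists>C. \<forall>x\<in>U. \<forall>y\<in>V. f x * f' y * q (Y.D w (XY.D u \<gamma> x) y) \<le> C"
    using nested_bounded[OF g] by blast
qed (rule nested_jointly_continuous[OF g])

lemma exchange:
  assumes o: "o_condition U W1" and g: "\<gamma> \<in> XY.S"
  shows exchange_space: "(\<lambda>y x. \<gamma> x y) \<in> YX.S"
    and exchange_derivatives: "admissible k u \<Longrightarrow> admissible l w \<Longrightarrow>
      X.D u (YX.D w (\<lambda>y x. \<gamma> x y) y) x = Y.D w (XY.D u \<gamma> x) y"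
proof -
  interpret M: mixed_family sc T k U W1 l V W2 "\<lambda>u w x y. Y.D w (XY.D u \<gamma> x) y"
    by (rule mixed_family_nested[OF g])
  have eq: "M.slice [] = (\<lambda>y x. \<gamma> x y)" by (simp add: M.slice_def fun_eq_iff)
  show "(\<lambda>y x. \<gamma> x y) \<in> YX.S" using M.slices_space[OF o] unfolding eq .
  show "X.D u (YX.D w (\<lambda>y x. \<gamma> x y) y) x = Y.D w (XY.D u \<gamma> x) y"
    if "admissible k u" "admissible l w"
    using M.iterated_partial_slices[OF o that(2)] M.iterated_partial_slice[OF that] unfolding eq by simp
qed

text \<open>Both sides are the supremum over \<open>x\<close> and \<open>y\<close> of the same function, taken in different order.\<close>

lemma exchange_norm_le:
  assumes o: "o_condition U W1" and g: "\<gamma> \<in> XY.S" and u: "admissible k u" and w: "admissible l w"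
    and f: "f \<in> W1" "f' \<in> W2" and q: "q \<in> X.CS"
  shows "YX.N f' w (X.N f u q) (\<lambda>y x. \<gamma> x y) \<le> XY.N f u (Y.N f' w q) \<gamma>"
proof (rule weighted_norm_leI)
  fix y assume y: "y \<in> V"
  let ?C = "XY.N f u (Y.N f' w q) \<gamma>"
  show "f' y * X.N f u q (YX.D w (\<lambda>y x. \<gamma> x y) y) \<le> ?C"
  proof (cases "f' y = 0")
    case False
    then have pos: "0 < f' y" using Y.weight_nonneg[OF f(2) y] by simp
    have "X.N f u q (YX.D w (\<lambda>y x. \<gamma> x y) y) \<le> ?C / f' y"
    proof (rule weighted_norm_leI)
      fix x assume x: "x \<in> U"
      show "f x * q (X.D u (YX.D w (\<lambda>y x. \<gamma> x y) y) x) \<le> ?C / f' y"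
        using nested_bounded[OF g u w f q x y] exchange_derivatives[OF o g u w, of y x] pos
        by (simp add: field_simps)
    qed (use pos in simp)
    then show ?thesis using pos by (simp add: field_simps)
  qed simp
qed simp

text \<open>
  A continuous seminorm on the inner space is bounded by a finite sum of weighted norms, and for
  these the two iterated suprema are exchanged.
\<close>

lemma exchange_seminorm_dominated:
  assumes o: "o_condition U W1" and n: "n \<in> weighted_norms (fun_scale sc) X.F l W2 V"
  shows "\<exists>m\<in>XY.fun_space.CS. \<forall>\<gamma>\<in>XY.S. n (\<lambda>y x. \<gamma> x y) \<le> m \<gamma>"
proof -
  obtain f' w p where n: "n = YX.N f' w p" "f' \<in> W2" "admissible l w" "p \<in> X.fun_space.CS"
    using n unfolding weighted_norms_def by blast
  obtain Q C where Q: "finite Q" "Q \<subseteq> weighted_norms sc T k W1 U" "0 \<le> C"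
      "\<And>\<eta>. \<eta> \<in> X.S \<Longrightarrow> p \<eta> \<le> C * (\<Sum>r\<in>Q. r \<eta>)"
    using X.fun_space.continuous_seminorm_dominated n(4) unfolding X.F_eq by metis
  have Q_CS: "r \<in> X.fun_space.CS" if "r \<in> Q" for r
    using Q(2) that X.N_CS unfolding weighted_norms_def by blast
  have "\<forall>r\<in>Q. \<exists>m. m \<in> XY.fun_space.CS \<and> (\<forall>\<gamma>\<in>XY.S. YX.N f' w r (\<lambda>y x. \<gamma> x y) \<le> m \<gamma>)"
  proof
    fix r assume "r \<in> Q"
    then obtain f u q where r: "r = X.N f u q" "f \<in> W1" "admissible k u" "q \<in> X.CS"
      using Q(2) unfolding weighted_norms_def by blast
    have "XY.N f u (Y.N f' w q) \<in> XY.fun_space.CS"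
      by (rule XY.N_CS[OF r(2,3) Y.N_CS[OF n(2,3) r(4)]])
    then show "\<exists>m. m \<in> XY.fun_space.CS \<and> (\<forall>\<gamma>\<in>XY.S. YX.N f' w r (\<lambda>y x. \<gamma> x y) \<le> m \<gamma>)"
      using exchange_norm_le[OF o _ r(3) n(3) r(2) n(2) r(4)] unfolding r(1) by blast
  qed
  from bchoice[OF this] obtain m where m: "\<forall>r\<in>Q. m r \<in> XY.fun_space.CS \<and>
      (\<forall>\<gamma>\<in>XY.S. YX.N f' w r (\<lambda>y x. \<gamma> x y) \<le> m r \<gamma>)" ..
  then have m_CS: "m r \<in> XY.fun_space.CS" if "r \<in> Q" for r using that by blast
  have "n (\<lambda>y x. \<gamma> x y) \<le> C * (\<Sum>r\<in>Q. m r \<gamma>)" if g: "\<gamma> \<in> XY.S" for \<gamma>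
    unfolding n(1)
  proof (rule weighted_norm_leI)
    let ?\<gamma> = "\<lambda>y x. \<gamma> x y"
    have nonneg: "0 \<le> m r \<gamma>" if "r \<in> Q" for r using XY.fun_space.CS_nonneg[OF m_CS[OF that]] g by simp
    show "0 \<le> C * (\<Sum>r\<in>Q. m r \<gamma>)" using Q(3) nonneg by (intro mult_nonneg_nonneg sum_nonneg)
    fix y assume y: "y \<in> V"
    note S = exchange_space[OF o g]
    have "YX.D w ?\<gamma> y \<in> X.S" using YX.D_topspace[OF YX.S_Ck[OF S] n(3)] by simp
    then have "f' y * p (YX.D w ?\<gamma> y) \<le> f' y * (C * (\<Sum>r\<in>Q. r (YX.D w ?\<gamma> y)))"
      using Q(4) Y.weight_nonneg[OF n(2) y] by (intro mult_left_mono)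
    also have "\<dots> = C * (\<Sum>r\<in>Q. f' y * r (YX.D w ?\<gamma> y))" by (simp add: sum_distrib_left mult.left_commute)
    also have "\<dots> \<le> C * (\<Sum>r\<in>Q. m r \<gamma>)"
    proof (intro mult_left_mono sum_mono Q(3))
      fix r assume r: "r \<in> Q"
      show "f' y * r (YX.D w ?\<gamma> y) \<le> m r \<gamma>"
        using weighted_norm_upper[OF S n(2) Q_CS[OF r] n(3) y] bspec[OF conjunct2[OF bspec[OF m r]] g]
        by linarith
    qed
    finally show "f' y * p (YX.D w ?\<gamma> y) \<le> C * (\<Sum>r\<in>Q. m r \<gamma>)" .
  qed
  moreover have "(\<lambda>\<gamma>. C * (\<Sum>r\<in>Q. m r \<gamma>)) \<in> XY.fun_space.CS"
    using Q(1,3) m_CS by (intro XY.fun_space.CS_mult_sum)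
  ultimately show ?thesis by (intro bexI[of _ "\<lambda>\<gamma>. C * (\<Sum>r\<in>Q. m r \<gamma>)"] ballI)
qed

lemma continuous_exchange:
  assumes o: "o_condition U W1"
  shows "continuous_map XY.F YX.F (\<lambda>\<gamma> y x. \<gamma> x y)"
  unfolding continuous_map_atin YX.F_eq
proof (intro ballI YX.fun_space.limitin_generators)
  fix \<gamma> assume "\<gamma> \<in> topspace XY.F"
  then have g: "\<gamma> \<in> XY.S" by simp
  show "(\<lambda>y x. \<gamma> x y) \<in> YX.S" using exchange_space[OF o g] .
  show "\<forall>\<^sub>F \<eta> in atin XY.F \<gamma>. (\<lambda>y x. \<eta> x y) \<in> YX.S"
    unfolding eventually_atin
    using exchange_space[OF o] g openin_topspace[of XY.F]
    by (intro disjI2 exI[of _ "topspace XY.F"]) auto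
  fix n and e :: real assume n: "n \<in> weighted_norms (fun_scale sc) X.F l W2 V" and e: "0 < e"
  obtain m where m: "m \<in> XY.fun_space.CS" "\<And>\<gamma>. \<gamma> \<in> XY.S \<Longrightarrow> n (\<lambda>y x. \<gamma> x y) \<le> m \<gamma>"
    using exchange_seminorm_dominated[OF o n] by blast
  let ?B = "{\<eta> \<in> topspace XY.F. m (\<eta> - \<gamma>) < e}"
  have "n ((\<lambda>y x. \<eta> x y) - (\<lambda>y x. \<gamma> x y)) < e" if "\<eta> \<in> ?B" for \<eta>
  proof -
    have "(\<lambda>y x. \<eta> x y) - (\<lambda>y x. \<gamma> x y) = (\<lambda>y x. (\<eta> - \<gamma>) x y)" by (simp add: fun_eq_iff)
    then show ?thesis using m(2)[OF XY.S_diff[of \<eta> \<gamma>]] g that by simp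
  qed
  moreover have "openin XY.F ?B" using m(1) g by (intro XY.fun_space.openin_ball) auto
  moreover have "\<gamma> \<in> ?B" using g e XY.fun_space.CS_0[OF m(1)] by simp
  ultimately show "\<forall>\<^sub>F \<eta> in atin XY.F \<gamma>. n ((\<lambda>y x. \<eta> x y) - (\<lambda>y x. \<gamma> x y)) < e"
    unfolding eventually_atin by blast
qed

end

lemma (in seminorm_space) weighted_space_of_smooth_weights:
  assumes "open U" "set_of_weights U W" "W \<subseteq> Ck_nonneg k U"
  shows "weighted_space sc T U W"
proof unfold_locales
  fix f assume "f \<in> W"
  then have "f \<in> Ck (*) euclideanreal k U" using assms(3) by (auto simp: Ck_nonneg_def)
  from continuous_map_iterated_partial[OF this admissible_Nil] show "continuous_on U f" by simp
qed (use assms in auto)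

theorem corollary3p38:
  fixes sc :: "'k::real_normed_field \<Rightarrow> 'e::ab_group_add \<Rightarrow> 'e"
    and T :: "'e topology"
    and U :: "(real^'n::{finite,linorder}) set"
    and V :: "(real^'m::{finite,linorder}) set"
    and k l :: enat
    and W1 :: "(real^'n::{finite,linorder} \<Rightarrow> real) set"
    and W2 :: "(real^'m::{finite,linorder} \<Rightarrow> real) set"
  assumes "locally_convex_space sc T" and "Hausdorff_space T"
    and "open U" and "open V"
    and "set_of_weights U W1" and "W1 \<subseteq> Ck_nonneg k U"
    and "o_condition U W1"
    and "\<And>f \<alpha>. f \<in> W1 \<Longrightarrow> enat (abs_index \<alpha>) \<le> k \<Longrightarrow>
           \<exists>g\<in>W1. \<forall>x\<in>U. \<bar>real_partial U \<alpha> f x\<bar> \<le> g x"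
    and "set_of_weights V W2" and "W2 \<subseteq> Ck_nonneg l V"
    and "o_condition V W2"
    and "\<And>f \<beta>. f \<in> W2 \<Longrightarrow> enat (abs_index \<beta>) \<le> l \<Longrightarrow>
           \<exists>g\<in>W2. \<forall>y\<in>V. \<bar>real_partial V \<beta> f y\<bar> \<le> g y"
  shows "let \<Psi> = (\<lambda>\<gamma>. \<lambda>y. \<lambda>x. \<gamma> x y) in
    Vector_Spaces.linear (fun_scale (fun_scale sc)) (fun_scale (fun_scale sc)) \<Psi> \<and>
    homeomorphic_map
      (weighted_Ck_topology (fun_scale sc) (weighted_Ck_topology sc T l W2 V) k W1 U)
      (weighted_Ck_topology (fun_scale sc) (weighted_Ck_topology sc T k W1 U) l W2 V)
      \<Psi>"
proof -
  interpret E: seminorm_space sc T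
    by (rule locally_convex_space.seminorm_space[OF assms(1,2)])
  interpret XY: two_weighted_spaces sc T k U W1 l V W2
    by (intro two_weighted_spaces.intro E.weighted_space_of_smooth_weights[OF assms(3,5,6)]
        E.weighted_space_of_smooth_weights[OF assms(4,9,10)])
  interpret YX: two_weighted_spaces sc T l V W2 k U W1
    by (intro two_weighted_spaces.intro E.weighted_space_of_smooth_weights[OF assms(3,5,6)]
        E.weighted_space_of_smooth_weights[OF assms(4,9,10)])
  let ?\<Psi> = "\<lambda>\<gamma>. \<lambda>y. \<lambda>x. \<gamma> x y"
  have "Vector_Spaces.linear (fun_scale (fun_scale sc)) (fun_scale (fun_scale sc)) ?\<Psi>"
    unfolding Vector_Spaces.linear_iff
    by (intro conjI vector_space_fun_scale E.vector_space_axioms) (auto simp: fun_eq_iff fun_scale_def)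
  moreover have "homeomorphic_maps
      (weighted_Ck_topology (fun_scale sc) (weighted_Ck_topology sc T l W2 V) k W1 U)
      (weighted_Ck_topology (fun_scale sc) (weighted_Ck_topology sc T k W1 U) l W2 V)
      ?\<Psi> ?\<Psi>"
    unfolding homeomorphic_maps_def
    using XY.continuous_exchange[OF assms(7)] YX.continuous_exchange[OF assms(11)] by simp
  ultimately show ?thesis
    unfolding Let_def homeomorphic_map_maps by blast
qed

end
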